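(* Let $\mathcal{X}=\mathbb{R}^2$ and $\mathcal{C}=\{x\mapsto\mathrm{sign}(w^\top x+b): w\in\mathbb{R}^2, b\in\mathbb{R}\}$ be the class of halfspaces in $\mathbb{R}^2$. There is a learner for the adversarial injection model (not given $\mathcal{D}$) such that for every target $c^\star\in\mathcal{C}$, every distribution $\mathcal{D}$ on $\mathbb{R}^2$ and every adaptive adversary, \[ \mathbb{E}[err_{\mathrm{mis}}+err_{\mathrm{abs}}]\le\tilde{\mathcal{O}}\!\left(T^{2/3}\right). \]
   Context: $\mathrm{sign}(z)=+1$ if $z\ge0$ and $-1$ if $z<0$. Adversarial injection model: an adversary fixes a target $c^\star\in\mathcal{C}$ and a distribution $\mathcal{D}$ over $\mathcal{X}$, unknown to the learner. For rounds $t=1,\dots,T$: the adversary chooses a hidden bit $q_t\in\{0,1\}$ (possibly depending on the past); if $q_t=0$, $x_t\sim\mathcal{D}$ independently of the past; if $q_t=1$, the adversary chooses $x_t\in\mathcal{X}$ arbitrarily. The learner observes $x_t$ (never $q_t$), outputs $\hat y_t\in\{+1,-1,\perp\}$ ($\perp$ = abstain), then observes $y_t=c^\star(x_t)$. $err_{\mathrm{mis}}=\sum_{t=1}^T\mathbf{1}[\hat y_t\ne y_t\wedge\hat y_t\ne\perp]$, $err_{\mathrm{abs}}=\sum_{t=1}^T\mathbf{1}[\hat y_t=\perp\wedge q_t=0]$; expectation over the i.i.d. draws and any randomness of adversary and learner. $\tilde{\mathcal{O}}$ hides constants and polylogarithmic factors in $T$. *)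

theory Defs
  imports "HOL-Probability.Probability"
begin

type_synonym pt = "real^2"
(* one round of the full game: (x_t, q_t, y_t, prediction); prediction None = abstain *)
type_synonym ent = "pt \<times> bool \<times> int \<times> int option"
(* what the learner sees of one round: (x_t, y_t, its own prediction) *)
type_synonym lent = "pt \<times> int \<times> int option"

(* learner: round index, learner-visible history (rounds < t), current point -> distribution of prediction *)
type_synonym learner = "nat \<Rightarrow> (nat \<Rightarrow> lent) \<Rightarrow> pt \<Rightarrow> int option pmf"
(* deterministic adversary strategy (given its random seed): round index, full history -> (q_t, injected point) *)
type_synonym adv = "nat \<Rightarrow> (nat \<Rightarrow> ent) \<Rightarrow> bool \<times> pt"

definition sgn_pm :: "real \<Rightarrow> int" where
  "sgn_pm z = (if z \<ge> 0 then 1 else -1)"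

definition halfspace :: "pt \<Rightarrow> real \<Rightarrow> pt \<Rightarrow> int" where
  "halfspace w b x = sgn_pm (w \<bullet> x + b)"

definition entM :: "ent measure" where
  "entM = (borel :: pt measure) \<Otimes>\<^sub>M count_space UNIV"

definition histM :: "(nat \<Rightarrow> ent) measure" where
  "histM = Pi\<^sub>M UNIV (\<lambda>_. entM)"

definition lentM :: "lent measure" where
  "lentM = (borel :: pt measure) \<Otimes>\<^sub>M count_space UNIV"

definition lhistM :: "(nat \<Rightarrow> lent) measure" where
  "lhistM = Pi\<^sub>M UNIV (\<lambda>_. lentM)"

definition default_ent :: ent where
  "default_ent = (0, False, 0, None)"

definition view :: "(nat \<Rightarrow> ent) \<Rightarrow> (nat \<Rightarrow> lent)" where
  "view h = (\<lambda>i. (fst (h i), fst (snd (snd (h i))), snd (snd (snd (h i)))))"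

definition loss :: "int option \<Rightarrow> int \<Rightarrow> bool \<Rightarrow> ennreal" where
  "loss p y q = (if p \<noteq> None \<and> p \<noteq> Some y then 1 else 0) + (if p = None \<and> \<not> q then 1 else 0)"

(* expected remaining error: n rounds left, current round t, history h (entries \<ge> t are default) *)
fun V :: "learner \<Rightarrow> adv \<Rightarrow> pt measure \<Rightarrow> (pt \<Rightarrow> int) \<Rightarrow> nat \<Rightarrow> nat \<Rightarrow> (nat \<Rightarrow> ent) \<Rightarrow> ennreal" where
  "V L A D c 0 t h = 0"
| "V L A D c (Suc n) t h =
     (let step = (\<lambda>q x. \<integral>\<^sup>+ p. (loss p (c x) q + V L A D c n (Suc t) (h(t := (x, q, c x, p))))
                           \<partial>measure_pmf (L t (view h) x))
      in case A t h of (q, z) \<Rightarrow> if q then step True z else \<integral>\<^sup>+ x. step False x \<partial>D)"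

(* E[err_mis + err_abs] over T rounds; adversary randomness = seed \<rho> ~ R drawn at the start *)
definition exp_err :: "learner \<Rightarrow> (real \<Rightarrow> adv) \<Rightarrow> real measure \<Rightarrow> pt measure \<Rightarrow> (pt \<Rightarrow> int) \<Rightarrow> nat \<Rightarrow> ennreal" where
  "exp_err L A R D c T = (\<integral>\<^sup>+ \<rho>. V L (A \<rho>) D c T 0 (\<lambda>_. default_ent) \<partial>R)"

definition learner_measurable :: "learner \<Rightarrow> bool" where
  "learner_measurable L \<longleftrightarrow>
     (\<forall>t p. (\<lambda>(v, x). pmf (L t v x) p) \<in> borel_measurable (lhistM \<Otimes>\<^sub>M (borel :: pt measure)))"

definition adversary_measurable :: "real measure \<Rightarrow> (real \<Rightarrow> adv) \<Rightarrow> bool" where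
  "adversary_measurable R A \<longleftrightarrow>
     (\<forall>t. (\<lambda>(\<rho>, h). A \<rho> t h) \<in> (R \<Otimes>\<^sub>M histM) \<rightarrow>\<^sub>M (count_space UNIV \<Otimes>\<^sub>M (borel :: pt measure)))"

end

theory Submission
  imports Defs
begin

text \<open>
  After the first labelled point \<open>(x\<^sub>0, y\<^sub>0)\<close> a halfspace can be normalised to \<open>w \<bullet> x\<^sub>0 + b = y\<^sub>0\<close>, so it is a
  point \<open>w\<close> of the dual plane and every instance \<open>x\<close> is a line there; labels say on which side of the lines the
  target lies. The learner keeps the convex region \<open>C\<close> of all \<open>w\<close> consistent with the rounds on which it
  erred. Its potential counts the past lines crossing \<open>C\<close> (each with weight \<open>N\<close>) and the pairs of past lines
  crossing each other inside \<open>C\<close>. It predicts a label if the opposite label would lower the potential by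
  \<open>N\<^sup>2 / 4\<close>, so it errs \<open>O(T\<^sup>2 / N\<^sup>2)\<close> times.

  If it abstains on \<open>x\<close>, then either fewer than \<open>N\<close> past lines cross \<open>C\<close>, or \<open>x\<close> crosses inside \<open>C\<close> a constant
  fraction of these lines, each of which has fewer than \<open>N\<close> crossings with past lines. For two distinct lines meet
  only once, so on cutting \<open>C\<close> along \<open>x\<close> each crossing survives on at most one side, and if the crossed lines
  had many crossings, one of the two labels of \<open>x\<close> would destroy too many of them. Both events have
  probability \<open>O(N / j)\<close> for a fresh point after \<open>j\<close> clean ones. Indeed, the set of lines crossing a polygon
  with \<open>K\<close> vertices, or a chord of it, is described by at most \<open>K\<close> hypotheses, and the swapping argument with
  a ghost sample of \<open>j\<close> points shows that no such set has fewer than \<open>N\<close> past and \<open>4 N\<close> ghost hits once \<open>N\<close>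
  exceeds \<open>K log T\<close>. Injected points only add hits to the past. The choice \<open>N = T\<^sup>2\<^sup>/\<^sup>3 log T\<close> balances all terms.
\<close>

section \<open>Sauer--Shelah and dichotomies of planar samples\<close>

definition shatters_set :: "'a set set \<Rightarrow> 'a set \<Rightarrow> bool" where
  "shatters_set F Y \<longleftrightarrow> Pow Y \<subseteq> (\<lambda>A. A \<inter> Y) ` F"

lemma shatters_setD: "shatters_set F Y \<Longrightarrow> Z \<subseteq> Y \<Longrightarrow> \<exists>A\<in>F. A \<inter> Y = Z"
  unfolding shatters_set_def by blast

text \<open>Pajor's form of the lemma. Splitting at \<open>x\<close>, the family \<open>P\<close>
  holds the members without \<open>x\<close> and \<open>Q\<close> the others with \<open>x\<close>
  removed, so \<open>card F = card (P \<union> Q) + card (P \<inter> Q)\<close>. What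
  \<open>P \<union> Q\<close> shatters is shattered by \<open>F\<close>, and what
  \<open>P \<inter> Q\<close> shatters remains shattered by \<open>F\<close> with \<open>x\<close>
  inserted; the induction hypothesis thus counts two disjoint families.\<close>

lemma card_le_card_shattered:
  assumes "finite X" "F \<subseteq> Pow X"
  shows "card F \<le> card {Y. Y \<subseteq> X \<and> shatters_set F Y}"
  using assms
proof (induction X arbitrary: F rule: finite_induct)
  case empty
  then consider "F = {}" | "F = {{}}" by auto
  then show ?case
  proof cases
    case 2
    then have "{Y. Y \<subseteq> {} \<and> shatters_set F Y} = {{}}" by (auto simp: shatters_set_def)
    then show ?thesis using 2 by simp
  qed auto
next
  case (insert x X)
  have finF: "finite F" using insert.prems insert.hyps by (meson finite_Pow_iff finite_insert finite_subset)
  define P where "P = {A \<in> F. x \<notin> A}"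
  define Q where "Q = (\<lambda>A. A - {x}) ` {A \<in> F. x \<in> A}"
  let ?S = "\<lambda>F. {Y. Y \<subseteq> X \<and> shatters_set F Y}"
  have fin: "finite P" "finite Q" using finF by (auto simp: P_def Q_def)
  have "F = P \<union> {A \<in> F. x \<in> A}" "P \<inter> {A \<in> F. x \<in> A} = {}" by (auto simp: P_def)
  then have "card F = card P + card {A \<in> F. x \<in> A}"
    using finF by (metis card_Un_disjoint finite_Un)
  also have "card {A \<in> F. x \<in> A} = card Q"
    unfolding Q_def by (rule card_image[symmetric]) (auto simp: inj_on_def)
  also have "card P + card Q = card (P \<union> Q) + card (P \<inter> Q)"
    using fin by (rule card_Un_Int)
  also have "\<dots> \<le> card (?S (P \<union> Q)) + card (?S (P \<inter> Q))"
    using insert.prems by (intro add_mono insert.IH) (auto simp: P_def Q_def)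
  also have "card (?S (P \<inter> Q)) = card (insert x ` ?S (P \<inter> Q))"
    using insert.hyps by (intro card_image[symmetric]) (auto simp: inj_on_def insert_eq_iff)
  also have "card (?S (P \<union> Q)) + card (insert x ` ?S (P \<inter> Q)) = card (?S (P \<union> Q) \<union> insert x ` ?S (P \<inter> Q))"
    using insert.hyps by (intro card_Un_disjoint[symmetric]) auto
  also have "\<dots> \<le> card {Y. Y \<subseteq> insert x X \<and> shatters_set F Y}"
  proof (rule card_mono)
    show "finite {Y. Y \<subseteq> insert x X \<and> shatters_set F Y}"
      using insert.hyps by simp
    have "shatters_set F Y" if Y: "Y \<subseteq> X" "shatters_set (P \<union> Q) Y" for Y
      unfolding shatters_set_def
    proof
      fix Z assume "Z \<in> Pow Y"
      then obtain A where "A \<in> P \<union> Q" "A \<inter> Y = Z" using shatters_setD[OF Y(2)] by blast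
      then obtain A' where "A' \<in> F" "A = A' - {x}" by (auto simp: P_def Q_def)
      moreover have "x \<notin> Y" using Y insert.hyps by auto
      ultimately show "Z \<in> (\<lambda>A. A \<inter> Y) ` F" using \<open>A \<inter> Y = Z\<close> by auto
    qed
    moreover have "shatters_set F (insert x Y)" if Y: "Y \<subseteq> X" "shatters_set (P \<inter> Q) Y" for Y
      unfolding shatters_set_def
    proof
      fix Z assume Z: "Z \<in> Pow (insert x Y)"
      then have "Z - {x} \<in> Pow Y" by auto
      then obtain A where A: "A \<in> P \<inter> Q" "A \<inter> Y = Z - {x}" using shatters_setD[OF Y(2)] by blast
      then obtain A' where "A \<in> F" "x \<notin> A" "A' \<in> F" "x \<in> A'" "A = A' - {x}" by (auto simp: P_def Q_def)
      then have "insert x A \<in> F" by (simp add: insert_absorb)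
      then show "Z \<in> (\<lambda>A. A \<inter> insert x Y) ` F"
      proof (cases "x \<in> Z")
        case True
        then have "insert x A \<inter> insert x Y = Z" using A(2) by blast
        then show ?thesis using \<open>insert x A \<in> F\<close> by blast
      next
        case False
        then have "A \<inter> insert x Y = Z" using A(2) \<open>x \<notin> A\<close> by blast
        then show ?thesis using \<open>A \<in> F\<close> by blast
      qed
    qed
    ultimately show "?S (P \<union> Q) \<union> insert x ` ?S (P \<inter> Q) \<subseteq> {Y. Y \<subseteq> insert x X \<and> shatters_set F Y}"
      by auto
  qed
  finally show ?case .
qed

section \<open>Dichotomies of a planar sample by strict halfspaces\<close>

definition dichotomies :: "nat \<Rightarrow> (nat \<Rightarrow> pt) \<Rightarrow> nat set set" where
  "dichotomies n x = {I. I \<subseteq> {..<n} \<and>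
     (\<exists>w b. \<forall>i<n. if i \<in> I then w \<bullet> x i + b > 0 else w \<bullet> x i + b < 0)}"

lemma finite_dichotomies [simp]: "finite (dichotomies n x)"
  by (rule finite_subset[of _ "Pow {..<n}"]) (auto simp: dichotomies_def)

text \<open>Four points of the plane are affinely dependent, so Radon's theorem yields two disjoint
  parts with intersecting convex hulls, and no line separates these strictly.\<close>

lemma shattered_by_dichotomies_card:
  assumes "Y \<subseteq> {..<n}" "shatters_set (dichotomies n x) Y"
  shows "card Y \<le> 3"
proof (rule ccontr)
  assume "\<not> card Y \<le> 3"
  have sep: "\<exists>w b. \<forall>i\<in>Y. if i \<in> Z then w \<bullet> x i + b > 0 else w \<bullet> x i + b < 0" if "Z \<subseteq> Y" for Z
  proof -
    obtain A where "A \<in> dichotomies n x" "A \<inter> Y = Z"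
      using shatters_setD[OF assms(2) \<open>Z \<subseteq> Y\<close>] by blast
    then obtain w b where "\<forall>i<n. if i \<in> A then w \<bullet> x i + b > 0 else w \<bullet> x i + b < 0"
      by (auto simp: dichotomies_def)
    then have "if i \<in> Z then w \<bullet> x i + b > 0 else w \<bullet> x i + b < 0" if "i \<in> Y" for i
      using that \<open>A \<inter> Y = Z\<close> assms(1) by (cases "i \<in> Z") force+
    then show ?thesis by blast
  qed
  \<comment> \<open>Dichotomies are sets of indices, and a repeated point would make two indices
    inseparable. So the image of a shattered \<open>Y\<close> is as large as \<open>Y\<close>, and
    Radon's theorem applies to it.\<close>
  have "inj_on x Y"
  proof (rule inj_onI, rule ccontr)
    fix i k assume "i \<in> Y" "k \<in> Y" "x i = x k" "i \<noteq> k"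
    moreover obtain w b where "\<forall>l\<in>Y. if l \<in> {i} then w \<bullet> x l + b > 0 else w \<bullet> x l + b < 0"
      using sep[of "{i}"] \<open>i \<in> Y\<close> by blast
    ultimately have "w \<bullet> x i + b > 0" "w \<bullet> x k + b < 0" by force+
    then show False using \<open>x i = x k\<close> by simp
  qed
  then have "card (x ` Y) = card Y" by (rule card_image)
  moreover have "finite (x ` Y)" using assms(1) finite_subset by blast
  ultimately have "affine_dependent (x ` Y)"
    using \<open>\<not> card Y \<le> 3\<close> by (intro affine_dependent_biggerset) auto
  then obtain M P where MP: "M \<subseteq> x ` Y" "P \<subseteq> x ` Y" "M \<inter> P = {}" "convex hull M \<inter> convex hull P \<noteq> {}"
    using Radon by blast
  obtain w b where wb: "\<forall>i\<in>Y. if i \<in> {i \<in> Y. x i \<in> M} then w \<bullet> x i + b > 0 else w \<bullet> x i + b < 0"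
    using sep[of "{i \<in> Y. x i \<in> M}"] by blast
  have "convex hull M \<subseteq> {z. w \<bullet> z > - b}"
    using MP(1) wb by (intro hull_minimal convex_halfspace_gt) fastforce
  moreover have "convex hull P \<subseteq> {z. w \<bullet> z < - b}"
  proof (intro hull_minimal convex_halfspace_lt subsetI)
    fix z assume "z \<in> P"
    then obtain i where "i \<in> Y" "z = x i" "x i \<notin> M" using MP by blast
    then show "z \<in> {z. w \<bullet> z < - b}" using wb by auto
  qed
  ultimately show False using MP(4) by fastforce
qed

lemma card_dichotomies: "card (dichotomies n x) \<le> (n + 1) ^ 3"
proof -
  have "card (dichotomies n x) \<le> card {Y. Y \<subseteq> {..<n} \<and> shatters_set (dichotomies n x) Y}"
    by (rule card_le_card_shattered) (auto simp: dichotomies_def)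
  also have "\<dots> \<le> card (\<Union>k\<le>3. {Y. Y \<subseteq> {..<n} \<and> card Y = k})"
    using shattered_by_dichotomies_card by (intro card_mono) auto
  also have "\<dots> \<le> (\<Sum>k\<le>3. card {Y. Y \<subseteq> {..<n} \<and> card Y = k})"
    by (rule card_UN_le) simp
  also have "\<dots> = (\<Sum>k\<le>3. n choose k)"
    by (simp add: n_subsets)
  also have "\<dots> \<le> (\<Sum>k\<le>3. n ^ k)"
  proof (rule sum_mono)
    show "n choose k \<le> n ^ k" for k
      by (cases "k \<le> n") (auto simp: binomial_le_pow binomial_eq_0)
  qed
  also have "\<dots> \<le> (n + 1) ^ 3"
    by (simp add: eval_nat_numeral algebra_simps)
  finally show ?thesis .
qed

text \<open>Points on the line itself violate the strictness in \<open>dichotomies\<close>. Lowering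
  \<open>b\<close> by less than the least positive value makes them negative and changes no positive
  sign.\<close>

lemma positive_part_dichotomy: "{i. i < n \<and> w \<bullet> x i + b > 0} \<in> dichotomies n x"
proof -
  obtain e where e: "e > 0" "\<And>i. i < n \<Longrightarrow> w \<bullet> x i + b > 0 \<Longrightarrow> e < w \<bullet> x i + b"
  proof -
    let ?S = "insert 1 ((\<lambda>i. w \<bullet> x i + b) ` {i. i < n \<and> w \<bullet> x i + b > 0})"
    have S: "finite ?S" "?S \<noteq> {}" by auto
    then have "Min ?S > 0" by (subst Min_gr_iff) auto
    moreover have "Min ?S / 2 < w \<bullet> x i + b" if "i < n" "w \<bullet> x i + b > 0" for i
    proof -
      have "Min ?S \<le> w \<bullet> x i + b" using that S by (intro Min_le) auto
      then show ?thesis using \<open>Min ?S > 0\<close> by linarith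
    qed
    ultimately show thesis using that[of "Min ?S / 2"] by simp
  qed
  then show ?thesis
    unfolding dichotomies_def
    by (auto intro!: exI[of _ w] exI[of _ "b - e"] simp: not_less) (smt (verit))+
qed

lemma negative_part_dichotomy: "{i. i < n \<and> w \<bullet> x i + b < 0} \<in> dichotomies n x"
proof -
  have "w \<bullet> x i + b < 0 \<longleftrightarrow> - w \<bullet> x i + - b > 0" for i by auto
  then show ?thesis using positive_part_dichotomy[of n "- w" x "- b"] by presburger
qed

text \<open>Meant for sets on which some of at most \<open>K\<close> affine functions is positive
  and some is negative. The families \<open>I\<close> and \<open>J\<close> vary independently, which
  only enlarges the collection and makes it easy to count.\<close>

definition sign_regions :: "nat \<Rightarrow> nat \<Rightarrow> (nat \<Rightarrow> pt) \<Rightarrow> nat set set" where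
  "sign_regions K n x = (\<lambda>(I, J). (\<Union>k<K. I k) \<inter> (\<Union>k<K. J k)) `
     (({..<K} \<rightarrow>\<^sub>E dichotomies n x) \<times> ({..<K} \<rightarrow>\<^sub>E dichotomies n x))"

lemma finite_sign_regions [simp]: "finite (sign_regions K n x)"
  unfolding sign_regions_def by (intro finite_imageI finite_cartesian_product finite_PiE) auto

lemma sign_regions_subset: "B \<in> sign_regions K n x \<Longrightarrow> K > 0 \<Longrightarrow> B \<subseteq> {..<n}"
  by (fastforce simp: sign_regions_def dichotomies_def PiE_def Pi_def)

lemma card_sign_regions: "card (sign_regions K n x) \<le> (n + 1) ^ (6 * K)"
proof -
  have "card (sign_regions K n x) \<le> card (dichotomies n x) ^ K * card (dichotomies n x) ^ K"
    unfolding sign_regions_def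
    by (rule order.trans[OF card_image_le]) (auto intro!: finite_PiE simp: card_cartesian_product card_PiE)
  also have "\<dots> \<le> ((n + 1) ^ 3) ^ K * ((n + 1) ^ 3) ^ K"
    by (intro mult_mono power_mono card_dichotomies) auto
  also have "\<dots> = (n + 1) ^ (6 * K)"
    by (simp flip: power_mult power_add add: algebra_simps)
  finally show ?thesis .
qed

lemma sign_regionI:
  fixes E :: "(pt \<times> real) set"
  assumes "finite E" "E \<noteq> {}" "card E \<le> K"
  shows "{i. i < n \<and> (\<exists>(w, b)\<in>E. w \<bullet> x i + b > 0) \<and> (\<exists>(w, b)\<in>E. w \<bullet> x i + b < 0)} \<in> sign_regions K n x"
proof -
  obtain e where e: "e ` {..<K} = E"
  proof -
    obtain f where f: "bij_betw f {0..<card E} E" using assms(1) ex_bij_betw_nat_finite by blast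
    have c: "card E > 0" using assms by (simp add: card_gt_0_iff)
    \<comment> \<open>Repeating the first element pads the enumeration of \<open>E\<close> to
      exactly \<open>K\<close> entries.\<close>
    have "(\<lambda>k. f (if k < card E then k else 0)) ` {..<K} = E"
    proof -
      have "(\<lambda>k. if k < card E then k else 0) ` {..<K} = {0..<card E}"
        using assms(3) c by (auto simp: image_iff)
      then show ?thesis using f unfolding bij_betw_def by (metis image_image)
    qed
    then show thesis by (rule that)
  qed
  let ?I = "\<lambda>k\<in>{..<K}. {i. i < n \<and> fst (e k) \<bullet> x i + snd (e k) > 0}"
  let ?J = "\<lambda>k\<in>{..<K}. {i. i < n \<and> fst (e k) \<bullet> x i + snd (e k) < 0}"
  have "{i. i < n \<and> (\<exists>(w, b)\<in>E. w \<bullet> x i + b > 0) \<and> (\<exists>(w, b)\<in>E. w \<bullet> x i + b < 0)}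
      = (\<Union>k<K. ?I k) \<inter> (\<Union>k<K. ?J k)"
    unfolding e[symmetric] by (simp add: case_prod_beta) blast
  then show ?thesis
    unfolding sign_regions_def
    by (intro image_eqI[of _ _ "(?I, ?J)"]) (auto simp: positive_part_dichotomy negative_part_dichotomy)
qed

section \<open>Swapping the two halves of a double sample\<close>

definition swap_halves :: "nat \<Rightarrow> nat set \<Rightarrow> nat \<Rightarrow> nat" where
  "swap_halves j S i = (if i < j \<and> i \<in> S then i + j
     else if j \<le> i \<and> i < 2 * j \<and> i - j \<in> S then i - j else i)"

lemma swap_halves_swap_halves [simp]: "swap_halves j S (swap_halves j S i) = i"
  by (auto simp: swap_halves_def)

lemma inj_swap_halves: "inj (swap_halves j S)"
  by (metis injI swap_halves_swap_halves)

lemma swap_halves_less [simp]: "swap_halves j S i < 2 * j \<longleftrightarrow> i < 2 * j"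
  by (auto simp: swap_halves_def)

lemma dichotomies_swap:
  assumes "I \<in> dichotomies (2 * j) (\<lambda>i. x (swap_halves j S i))"
  shows "swap_halves j S ` I \<in> dichotomies (2 * j) x"
proof -
  let ?s = "swap_halves j S"
  obtain w b where wb: "I \<subseteq> {..<2*j}"
    "\<And>i. i < 2*j \<Longrightarrow> if i \<in> I then w \<bullet> x (?s i) + b > 0 else w \<bullet> x (?s i) + b < 0"
    using assms by (auto simp: dichotomies_def)
  have "if i \<in> ?s ` I then w \<bullet> x i + b > 0 else w \<bullet> x i + b < 0" if "i < 2 * j" for i
  proof -
    have "i \<in> ?s ` I \<longleftrightarrow> ?s i \<in> I" by (metis image_iff swap_halves_swap_halves)
    then show ?thesis using wb(2)[of "?s i"] that by (auto split: if_splits)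
  qed
  moreover have "?s ` I \<subseteq> {..<2*j}" using wb(1) by auto
  ultimately show ?thesis unfolding dichotomies_def by blast
qed

text \<open>Lets a single union bound, over the regions of the unswapped sample, serve all swaps at
  once.\<close>

lemma sign_regions_swap:
  assumes "B \<in> sign_regions K (2 * j) (\<lambda>i. x (swap_halves j S i))"
  shows "swap_halves j S ` B \<in> sign_regions K (2 * j) x"
proof -
  let ?s = "swap_halves j S"
  obtain I J where IJ: "I \<in> {..<K} \<rightarrow>\<^sub>E dichotomies (2 * j) (\<lambda>i. x (?s i))"
      "J \<in> {..<K} \<rightarrow>\<^sub>E dichotomies (2 * j) (\<lambda>i. x (?s i))" "B = (\<Union>k<K. I k) \<inter> (\<Union>k<K. J k)"
    using assms by (auto simp: sign_regions_def)
  have "?s ` B = (\<Union>k<K. (\<lambda>k\<in>{..<K}. ?s ` I k) k) \<inter> (\<Union>k<K. (\<lambda>k\<in>{..<K}. ?s ` J k) k)"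
    unfolding IJ(3) by (simp add: image_Int[OF inj_swap_halves] image_UN)
  then show ?thesis unfolding sign_regions_def
    using IJ(1,2) by (intro image_eqI[of _ _ "(\<lambda>k\<in>{..<K}. ?s ` I k, \<lambda>k\<in>{..<K}. ?s ` J k)"])
      (auto intro!: dichotomies_swap)
qed

definition unbalanced :: "nat \<Rightarrow> nat \<Rightarrow> nat set \<Rightarrow> bool" where
  "unbalanced N j B \<longleftrightarrow> card (B \<inter> {..<j}) < N \<and> 4 * N \<le> card (B \<inter> {j..<2 * j})"

text \<open>A Chernoff bound in counting form over all \<open>2 ^ j\<close> swaps. An unbalanced
  swap has fewer than \<open>N\<close> hits in the first half, so its weight
  \<open>2 ^ N * (1/2) ^ hits\<close> is at least 1. The total weight factors over the pairs
  \<open>{i, i + j}\<close>: with 0, 1 or 2 members in \<open>B\<close> a pair contributes 2, 3/2 or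
  1, which is at most \<open>2 * (3/4) ^ members\<close>. Finally \<open>card B \<ge> 4 * N\<close>
  and \<open>2 * (3/4) ^ 4 = 81/128\<close>.\<close>

lemma unbalanced_swaps:
  assumes B: "B \<subseteq> {..<2 * j}"
  shows "real (card {S. S \<subseteq> {..<j} \<and> unbalanced N j (swap_halves j S ` B)}) \<le> 2 ^ j * (81 / 128) ^ N"
proof (cases "4 * N \<le> card B")
  case False
  have "card (swap_halves j S ` B \<inter> {j..<2*j}) \<le> card B" for S
    by (metis B card_image_le card_mono finite_Int finite_imageI finite_lessThan finite_subset inf_le1 order.trans)
  then have "{S. S \<subseteq> {..<j} \<and> unbalanced N j (swap_halves j S ` B)} = {}"
    using False unfolding unbalanced_def by (metis (no_types, lifting) Collect_empty_eq order.trans)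
  then show ?thesis by (simp only: card.empty) simp
next
  case True
  let ?h = "\<lambda>P. (1 / 2 :: real) ^ (of_bool P)"
  let ?U = "{S. S \<subseteq> {..<j} \<and> unbalanced N j (swap_halves j S ` B)}"
  have first: "(\<Prod>i\<in>S. ?h (i + j \<in> B)) * (\<Prod>i\<in>{..<j} - S. ?h (i \<in> B))
      = (1 / 2) ^ card (swap_halves j S ` B \<inter> {..<j})" if "S \<subseteq> {..<j}" for S
  proof -
    have "swap_halves j S ` B \<inter> {..<j} = {i \<in> S. i + j \<in> B} \<union> {i \<in> {..<j} - S. i \<in> B}"
    proof (intro set_eqI)
      fix i
      have "i \<in> swap_halves j S ` B \<longleftrightarrow> swap_halves j S i \<in> B" by (metis image_iff swap_halves_swap_halves)
      then show "i \<in> swap_halves j S ` B \<inter> {..<j} \<longleftrightarrow> i \<in> {i \<in> S. i + j \<in> B} \<union> {i \<in> {..<j} - S. i \<in> B}"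
        using that by (auto simp: swap_halves_def)
    qed
    moreover have "finite S" using that finite_subset by blast
    ultimately have "card (swap_halves j S ` B \<inter> {..<j}) = card {i \<in> S. i + j \<in> B} + card {i \<in> {..<j} - S. i \<in> B}"
      by (simp, intro card_Un_disjoint) auto
    moreover have "(\<Prod>i\<in>A. ?h (P i)) = (1 / 2) ^ card {i \<in> A. P i}" if "finite A" for A :: "nat set" and P
      using that by (simp add: power_sum[symmetric] sum.inter_filter[symmetric] of_bool_def)
    ultimately show ?thesis using \<open>finite S\<close> by (simp add: power_add)
  qed
  have "real (card ?U) = (\<Sum>S\<in>?U. 1)" by simp
  also have "\<dots> \<le> (\<Sum>S\<in>?U. 2 ^ N * (1 / 2) ^ card (swap_halves j S ` B \<inter> {..<j}))"
  proof (rule sum_mono)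
    fix S assume "S \<in> ?U"
    then have "card (swap_halves j S ` B \<inter> {..<j}) \<le> N" by (simp add: unbalanced_def)
    then have "(1 / 2 :: real) ^ N \<le> (1 / 2) ^ card (swap_halves j S ` B \<inter> {..<j})"
      by (intro power_decreasing) auto
    then show "(1::real) \<le> 2 ^ N * (1 / 2) ^ card (swap_halves j S ` B \<inter> {..<j})"
      by (simp add: power_divide field_simps)
  qed
  also have "\<dots> \<le> (\<Sum>S\<in>Pow {..<j}. 2 ^ N * (1 / 2) ^ card (swap_halves j S ` B \<inter> {..<j}))"
    by (rule sum_mono2) auto
  \<comment> \<open>\<open>prod_add\<close> expands the product of sums over the sets
    \<open>S\<close> of swapped pairs.\<close>
  also have "\<dots> = 2 ^ N * (\<Prod>i<j. ?h (i + j \<in> B) + ?h (i \<in> B))"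
    by (subst prod_add) (auto simp: sum_distrib_left first intro!: sum.cong)
  also have "(\<Prod>i<j. ?h (i + j \<in> B) + ?h (i \<in> B)) \<le> (\<Prod>i<j. 2 * (3 / 4) ^ (of_bool (i + j \<in> B) + of_bool (i \<in> B)))"
    by (rule prod_mono) (auto simp: power2_eq_square)
  also have "\<dots> = 2 ^ j * (3 / 4) ^ card B"
  proof -
    have "(\<Sum>i<j. of_bool (i + j \<in> B) + of_bool (i \<in> B)) = card {i \<in> {..<j}. i + j \<in> B} + card {i \<in> {..<j}. i \<in> B}"
      by (simp add: sum.distrib of_bool_def sum.inter_filter[symmetric])
    also have "card {i \<in> {..<j}. i + j \<in> B} = card ((\<lambda>i. i + j) ` {i \<in> {..<j}. i + j \<in> B})"
      by (rule card_image[symmetric]) (auto simp: inj_on_def)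
    also have "(\<lambda>i. i + j) ` {i \<in> {..<j}. i + j \<in> B} = {i \<in> B. j \<le> i}"
    proof (intro set_eqI iffI)
      fix i assume i: "i \<in> {i \<in> B. j \<le> i}"
      then have "i < 2 * j" using B by auto
      then show "i \<in> (\<lambda>i. i + j) ` {i \<in> {..<j}. i + j \<in> B}"
        using i by (intro image_eqI[of _ _ "i - j"]) auto
    qed auto
    also have "card {i \<in> B. j \<le> i} + card {i \<in> {..<j}. i \<in> B} = card ({i \<in> B. j \<le> i} \<union> {i \<in> {..<j}. i \<in> B})"
      using B by (intro card_Un_disjoint[symmetric]) (auto intro: finite_subset)
    also have "{i \<in> B. j \<le> i} \<union> {i \<in> {..<j}. i \<in> B} = B" by auto
    finally show ?thesis by (simp add: prod.distrib power_sum[symmetric])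
  qed
  also have "(2::real) ^ N * (2 ^ j * (3 / 4) ^ card B) \<le> 2 ^ N * (2 ^ j * (3 / 4) ^ (4 * N))"
    using True by (intro mult_left_mono power_decreasing) auto
  also have "\<dots> = 2 ^ j * (81 / 128) ^ N"
  proof -
    have "(2::real) ^ N * (3 / 4) ^ (4 * N) = (2 * (3 / 4) ^ 4) ^ N"
      by (simp only: power_mult power_mult_distrib)
    also have "(2::real) * (3 / 4) ^ 4 = 81 / 128" by (simp add: eval_nat_numeral)
    finally have "(2::real) ^ N * (3 / 4) ^ (4 * N) = (81 / 128) ^ N" .
    then show ?thesis by (simp add: algebra_simps)
  qed
  finally show ?thesis by simp
qed

section \<open>Convex regions of the dual plane\<close>

definition aff :: "pt \<Rightarrow> real \<Rightarrow> pt \<Rightarrow> real" where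
  "aff z s w = w \<bullet> z + s"

definition splits :: "pt set \<Rightarrow> (pt \<Rightarrow> real) \<Rightarrow> bool" where
  "splits C g \<longleftrightarrow> (\<exists>w\<in>C. g w > 0) \<and> (\<exists>w\<in>C. g w < 0)"

definition half :: "pt set \<Rightarrow> (pt \<Rightarrow> real) \<Rightarrow> real \<Rightarrow> pt set" where
  "half C g s = {w \<in> C. s * g w > 0}"

text \<open>All four sign patterns of \<open>g\<close> and \<open>h\<close> occur on
  \<open>C\<close>. For affine \<open>g\<close>, \<open>h\<close> and convex \<open>C\<close> the
  lines \<open>g = 0\<close> and \<open>h = 0\<close> then cross inside \<open>C\<close>; this is
  the notion of crossing that the potential counts.\<close>

definition shatters :: "pt set \<Rightarrow> (pt \<Rightarrow> real) \<Rightarrow> (pt \<Rightarrow> real) \<Rightarrow> bool" where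
  "shatters C g h \<longleftrightarrow> splits (half C g 1) h \<and> splits (half C g (- 1)) h"

lemma splits_mono: "splits C g \<Longrightarrow> C \<subseteq> W \<Longrightarrow> splits W g"
  by (auto simp: splits_def)

lemma half_mono: "C \<subseteq> W \<Longrightarrow> half C g s \<subseteq> half W g s"
  by (auto simp: half_def)

lemma half_subset: "half C g s \<subseteq> C"
  by (auto simp: half_def)

lemma shatters_mono: "shatters C g h \<Longrightarrow> C \<subseteq> W \<Longrightarrow> shatters W g h"
  unfolding shatters_def by (meson half_mono splits_mono)

lemma aff_convex_combination:
  "\<alpha> + \<beta> = 1 \<Longrightarrow> aff z s (\<alpha> *\<^sub>R p + \<beta> *\<^sub>R q) = \<alpha> * aff z s p + \<beta> * aff z s q"
proof -
  assume "\<alpha> + \<beta> = 1"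
  then have "s = \<alpha> * s + \<beta> * s" by (metis distrib_right mult_1)
  then show ?thesis by (simp add: aff_def inner_add_left algebra_simps)
qed

lemma convex_aff_nonneg: "convex {w. 0 \<le> aff z s w}"
proof -
  have "{w. 0 \<le> aff z s w} = {w. z \<bullet> w \<ge> - s}" by (auto simp: aff_def inner_commute)
  then show ?thesis by (simp add: convex_halfspace_ge)
qed

lemma convex_aff_pos: "convex {w. 0 < aff z s w}"
proof -
  have "{w. 0 < aff z s w} = {w. z \<bullet> w > - s}" by (auto simp: aff_def inner_commute)
  then show ?thesis by (simp add: convex_halfspace_gt)
qed

lemma convex_aff_nonpos: "convex {w. aff z s w \<le> 0}"
proof -
  have "{w. aff z s w \<le> 0} = {w. z \<bullet> w \<le> - s}" by (auto simp: aff_def inner_commute)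
  then show ?thesis by (simp add: convex_halfspace_le)
qed

lemma convex_aff_neg: "convex {w. aff z s w < 0}"
proof -
  have "{w. aff z s w < 0} = {w. z \<bullet> w < - s}" by (auto simp: aff_def inner_commute)
  then show ?thesis by (simp add: convex_halfspace_lt)
qed

lemma convex_aff_zero: "convex {w. aff z s w = 0}"
proof -
  have "{w. aff z s w = 0} = {w. z \<bullet> w = - s}" by (auto simp: aff_def inner_commute)
  then show ?thesis by (simp add: convex_hyperplane)
qed

lemma collinear_aff_zero: "z \<noteq> 0 \<Longrightarrow> collinear {w. aff z s w = 0}"
proof -
  assume "z \<noteq> 0"
  moreover have "{w. aff z s w = 0} = {w. z \<bullet> w = - s}" by (auto simp: aff_def inner_commute)
  ultimately show ?thesis by (simp add: collinear_aff_dim aff_dim_hyperplane)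
qed

lemma convex_half: "convex C \<Longrightarrow> convex (half C (aff z s) c)"
proof -
  assume C: "convex C"
  have "half C (aff z s) c = C \<inter> {w. 0 < aff (c *\<^sub>R z) (c * s) w}"
    by (auto simp: half_def aff_def algebra_simps)
  then show ?thesis using C by (simp add: convex_Int convex_aff_pos)
qed

lemma aff_zero_between:
  assumes "aff z s p > 0" "aff z s q < 0"
  obtains \<alpha> \<beta> where "\<alpha> > 0" "\<beta> > 0" "\<alpha> + \<beta> = 1" "aff z s (\<alpha> *\<^sub>R p + \<beta> *\<^sub>R q) = 0"
proof -
  define d where "d = aff z s p - aff z s q"
  have d: "d > 0" using assms by (simp add: d_def)
  have "- aff z s q / d + aff z s p / d = (aff z s p - aff z s q) / d"
    by (simp add: diff_divide_distrib)
  then have 1: "- aff z s q / d + aff z s p / d = 1" using d by (simp add: d_def)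
  then have "aff z s ((- aff z s q / d) *\<^sub>R p + (aff z s p / d) *\<^sub>R q) = 0"
    by (subst aff_convex_combination) auto
  moreover have "- aff z s q / d > 0" "aff z s p / d > 0"
    using assms d by (auto intro!: divide_pos_pos simp: divide_neg_pos)
  ultimately show thesis using that 1 by blast
qed

lemma splits_zero_positive:
  assumes "convex C" "splits (half C (aff z s) c) (aff z' s')"
  shows "\<exists>w\<in>C. c * aff z s w > 0 \<and> aff z' s' w = 0"
proof -
  obtain p q where pq: "p \<in> half C (aff z s) c" "q \<in> half C (aff z s) c" "aff z' s' p > 0" "aff z' s' q < 0"
    using assms(2) by (auto simp: splits_def)
  obtain \<alpha> \<beta> where ab: "\<alpha> > 0" "\<beta> > 0" "\<alpha> + \<beta> = 1" "aff z' s' (\<alpha> *\<^sub>R p + \<beta> *\<^sub>R q) = 0"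
    using aff_zero_between[OF pq(3,4)] by blast
  have "\<alpha> *\<^sub>R p + \<beta> *\<^sub>R q \<in> half C (aff z s) c"
    using convex_half[OF assms(1)] pq(1,2) ab by (intro convexD) auto
  then show ?thesis using ab(4) by (auto simp: half_def)
qed

lemma shatters_line_crossed:
  assumes "convex C" "shatters C (aff z s) (aff z' s')"
  shows "\<exists>w\<in>C. aff z' s' w = 0 \<and> aff z s w > 0" "\<exists>w\<in>C. aff z' s' w = 0 \<and> aff z s w < 0"
  using splits_zero_positive[OF assms(1), of z s 1 z' s'] splits_zero_positive[OF assms(1), of z s "- 1" z' s'] assms(2)
  by (auto simp: shatters_def)

lemma shatters_crossing_point:
  assumes "convex C" "shatters C (aff z s) (aff z' s')"
  shows "\<exists>w\<in>C. aff z s w = 0 \<and> aff z' s' w = 0"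
proof -
  obtain p q where pq: "p \<in> C" "q \<in> C" "aff z' s' p = 0" "aff z' s' q = 0" "aff z s p > 0" "aff z s q < 0"
    using shatters_line_crossed[OF assms] by blast
  obtain \<alpha> \<beta> where ab: "\<alpha> > 0" "\<beta> > 0" "\<alpha> + \<beta> = 1" "aff z s (\<alpha> *\<^sub>R p + \<beta> *\<^sub>R q) = 0"
    using aff_zero_between[OF pq(5,6)] by blast
  have "\<alpha> *\<^sub>R p + \<beta> *\<^sub>R q \<in> C"
    using assms(1) pq(1,2) ab by (intro convexD) auto
  moreover have "aff z' s' (\<alpha> *\<^sub>R p + \<beta> *\<^sub>R q) = 0"
    using ab(3) pq by (simp add: aff_convex_combination)
  ultimately show ?thesis using ab(4) by blast
qed

text \<open>Otherwise the two lines share a point on either side of the cut, hence two distinct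
  points, hence they coincide. Their affine forms would be proportional, which contradicts the four
  sign patterns.\<close>

lemma not_shatters_both_sides:
  assumes C: "convex C"
    and pos: "shatters (half C (aff z s) 1) (aff z1 s1) (aff z2 s2)"
    and neg: "shatters (half C (aff z s) (- 1)) (aff z1 s1) (aff z2 s2)"
  shows False
proof -
  obtain p where p: "aff z1 s1 p = 0" "aff z2 s2 p = 0" "aff z s p > 0"
    using shatters_crossing_point[OF convex_half[OF C] pos] by (auto simp: half_def)
  obtain q where q: "aff z1 s1 q = 0" "aff z2 s2 q = 0" "aff z s q < 0"
    using shatters_crossing_point[OF convex_half[OF C] neg] by (auto simp: half_def)
  have "p \<noteq> q" using p q by auto
  obtain e e' where e: "aff z1 s1 e > 0" "aff z2 s2 e > 0" "aff z1 s1 e' > 0" "aff z2 s2 e' < 0"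
    using pos by (auto simp: shatters_def splits_def half_def)
  have i: "x \<bullet> y = x$1 * y$1 + x$2 * y$2" for x y :: pt
    by (simp add: inner_vec_def sum_2)
  define d1 d2 where "d1 = p$1 - q$1" and "d2 = p$2 - q$2"
  have d: "d1 \<noteq> 0 \<or> d2 \<noteq> 0"
    using \<open>p \<noteq> q\<close> by (auto simp: vec_eq_iff forall_2 d1_def d2_def)
  have o: "d1 * z1$1 + d2 * z1$2 = 0" "d1 * z2$1 + d2 * z2$2 = 0"
    using p q by (simp_all add: aff_def i d1_def d2_def algebra_simps)
  \<comment> \<open>Both normals are orthogonal to the nonzero vector \<open>p - q\<close>, so their
    determinant vanishes.\<close>
  have cr: "z1$1 * z2$2 = z1$2 * z2$1"
    using d
  proof
    assume d1: "d1 \<noteq> 0"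
    have "d1 * (z1$1 * z2$2) = d1 * (z1$2 * z2$1)" using o by algebra
    then show ?thesis using d1 by simp
  next
    assume d2: "d2 \<noteq> 0"
    have "d2 * (z1$1 * z2$2) = d2 * (z1$2 * z2$1)" using o by algebra
    then show ?thesis using d2 by simp
  qed
  have "aff z1 s1 e * aff z2 s2 e' = aff z1 s1 e' * aff z2 s2 e"
    using p(1,2) cr unfolding aff_def i by algebra
  moreover have "aff z1 s1 e * aff z2 s2 e' < 0" "aff z1 s1 e' * aff z2 s2 e > 0"
    using e by (auto simp: mult_pos_neg)
  ultimately show False by simp
qed

section \<open>Polygons that describe convex regions\<close>

lemma polygon_cut:
  fixes E :: "pt set"
  assumes "finite E"
  shows "\<exists>E'. finite E' \<and> card E' \<le> card E + 2 \<and> E' \<subseteq> convex hull E \<inter> {w. 0 \<le> aff z s w} \<and>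
    convex hull E \<inter> {w. 0 \<le> aff z s w} \<subseteq> convex hull E'"
proof (cases "z = 0")
  case True
  then have "{w. 0 \<le> aff z s w} = UNIV \<or> {w. 0 \<le> aff z s w} = {}"
    by (auto simp: aff_def)
  then show ?thesis
  proof
    assume "{w. 0 \<le> aff z s w} = UNIV"
    then show ?thesis using assms by (intro exI[of _ E]) (auto simp: hull_inc)
  qed (auto intro!: exI[of _ "{}"])
next
  case False
  \<comment> \<open>The new vertices are the endpoints of the chord \<open>Z\<close> cut out by the
    line. Together with the old vertices on the nonnegative side they span the cut polygon, so at
    most two are added.\<close>
  define Z where "Z = convex hull E \<inter> {w. aff z s w = 0}"
  have cl: "closed {w. aff z s w = 0}"
  proof -
    have "{w. aff z s w = 0} = {w. z \<bullet> w = - s}" by (auto simp: aff_def inner_commute)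
    then show ?thesis by (simp add: closed_hyperplane)
  qed
  have Z: "compact Z" "convex Z" "collinear Z"
    using assms cl collinear_aff_zero[OF False] unfolding Z_def
    by (auto intro!: compact_Int_closed convex_Int convex_aff_zero finite_imp_compact_convex_hull intro: collinear_subset)
  obtain G where G: "finite G" "card G \<le> 2" "G \<subseteq> Z" "Z \<subseteq> convex hull G"
  proof (cases "Z = {}")
    case True
    then show thesis using that[of "{}"] by simp
  next
    case False
    then obtain a b where "Z = closed_segment a b"
      using compact_convex_collinear_segment[OF _ Z] by metis
    then show thesis
      using that[of "{a, b}"] by (auto simp: segment_convex_hull card_insert_if hull_inc)
  qed
  define P where "P = {e \<in> E. 0 \<le> aff z s e}"
  define Q where "Q = {e \<in> E. aff z s e < 0}"
  have "card (P \<union> G) \<le> card P + card G" by (rule card_Un_le)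
  also have "\<dots> \<le> card E + 2"
    using G(2) assms by (intro add_mono card_mono) (auto simp: P_def)
  finally have card: "card (P \<union> G) \<le> card E + 2" .
  have sub: "P \<union> G \<subseteq> convex hull E \<inter> {w. 0 \<le> aff z s w}"
    using G(3) by (auto simp: P_def Z_def hull_inc)
  have "w \<in> convex hull (P \<union> G)" if w: "w \<in> convex hull E" "0 \<le> aff z s w" for w
  proof (cases "aff z s w = 0")
    case True
    then have "w \<in> convex hull G" using G(4) w by (auto simp: Z_def)
    then show ?thesis by (meson hull_mono sup_ge2 subsetD)
  next
    case False
    then have wpos: "aff z s w > 0" using w by simp
    have EPQ: "E = P \<union> Q" by (auto simp: P_def Q_def)
    have hP: "convex hull P \<subseteq> convex hull (P \<union> G)" by (simp add: hull_mono)
    have Qneg: "convex hull Q \<subseteq> {w. aff z s w < 0}"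
      by (intro hull_minimal convex_aff_neg) (auto simp: Q_def)
    consider "Q = {}" | "P = {}" | "P \<noteq> {}" "Q \<noteq> {}" by blast
    then show ?thesis
    proof cases
      case 1
      then show ?thesis using hP w EPQ by auto
    next
      case 2
      then show ?thesis using Qneg w wpos EPQ by auto
    next
      case 3
      have "convex hull E = convex hull (convex hull P \<union> convex hull Q)"
        unfolding EPQ by (metis hull_Un_left hull_Un_right)
      then obtain u v p q where uv: "w = u *\<^sub>R p + v *\<^sub>R q" "u \<ge> 0" "v \<ge> 0" "u + v = 1"
        "p \<in> convex hull P" "q \<in> convex hull Q"
        using w(1) 3 convex_hull_union_two[of "convex hull P" "convex hull Q"] by auto
      have qn: "aff z s q < 0" using uv(6) Qneg by auto
      have aw: "aff z s w = u * aff z s p + v * aff z s q"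
        using uv by (simp add: aff_convex_combination)
      have pp: "aff z s p > 0"
        using wpos aw uv(2,3) qn by (smt (verit) mult_nonneg_nonpos)
      obtain \<alpha> \<beta> where ab: "\<alpha> > 0" "\<beta> > 0" "\<alpha> + \<beta> = 1" "aff z s (\<alpha> *\<^sub>R p + \<beta> *\<^sub>R q) = 0"
        using aff_zero_between[OF pp qn] by blast
      let ?g = "\<alpha> *\<^sub>R p + \<beta> *\<^sub>R q"
      have "p \<in> convex hull E" "q \<in> convex hull E"
        using uv(5,6) EPQ by (metis hull_mono sup_ge1 sup_ge2 subsetD)+
      then have "?g \<in> Z" unfolding Z_def using ab
        by (auto intro!: convexD[OF convex_convex_hull])
      then have g: "?g \<in> convex hull (P \<union> G)"
        using G(4) by (meson hull_mono sup_ge2 subsetD)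
      \<comment> \<open>On the way from \<open>p\<close> to \<open>q\<close> the point
        \<open>w\<close> is still on the positive side, so it comes before the zero
        \<open>?g\<close> and is a convex combination of \<open>p\<close> and
        \<open>?g\<close>.\<close>
      have "v \<le> \<beta>"
      proof (rule ccontr)
        assume "\<not> v \<le> \<beta>"
        have "\<alpha> * aff z s p + \<beta> * aff z s q = 0" using ab by (simp add: aff_convex_combination)
        moreover have "u * aff z s p \<le> \<alpha> * aff z s p" "v * aff z s q \<le> \<beta> * aff z s q"
          using \<open>\<not> v \<le> \<beta>\<close> uv(4) ab(3) pp qn by (auto intro!: mult_right_mono mult_right_mono_neg)
        ultimately show False using aw wpos by linarith
      qed
      have "w = (1 - v / \<beta>) *\<^sub>R p + (v / \<beta>) *\<^sub>R ?g"
      proof -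
        have "(1 - v / \<beta>) + v / \<beta> * \<alpha> = u" "v / \<beta> * \<beta> = v"
        proof -
          have "(1 - v / \<beta>) + v / \<beta> * \<alpha> = 1 - v / \<beta> * (1 - \<alpha>)" by (simp add: right_diff_distrib)
          also have "1 - \<alpha> = \<beta>" using ab by simp
          finally show "(1 - v / \<beta>) + v / \<beta> * \<alpha> = u" using ab uv(4) by simp
          show "v / \<beta> * \<beta> = v" using ab by simp
        qed
        then have "(1 - v / \<beta>) *\<^sub>R p + (v / \<beta>) *\<^sub>R ?g = u *\<^sub>R p + v *\<^sub>R q"
          by (simp only: scaleR_add_right scaleR_scaleR scaleR_add_left[symmetric] add.assoc[symmetric])
        then show ?thesis using uv(1) by simp
      qed
      moreover have "(1 - v / \<beta>) *\<^sub>R p + (v / \<beta>) *\<^sub>R ?g \<in> convex hull (P \<union> G)"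
        using \<open>v \<le> \<beta>\<close> uv(3) ab(2) by (intro convexD_alt[OF convex_convex_hull subsetD[OF hP uv(5)] g]) auto
      ultimately show ?thesis by simp
    qed
  qed
  then show ?thesis using card sub G(1) assms
    by (intro exI[of _ "P \<union> G"]) (auto simp: P_def)
qed

lemma polygon_cuts:
  fixes E :: "pt set"
  assumes "finite I" "finite E"
  shows "\<exists>E'. finite E' \<and> card E' \<le> card E + 2 * card I \<and>
    E' \<subseteq> {w. \<forall>i\<in>I. 0 \<le> aff (z i) (s i) w} \<and>
    convex hull E \<inter> {w. \<forall>i\<in>I. 0 \<le> aff (z i) (s i) w} \<subseteq> convex hull E'"
  using assms(1)
proof (induction I rule: finite_induct)
  case empty
  then show ?case using assms(2) by (intro exI[of _ E]) auto
next
  case (insert j I)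
  then obtain E1 where E1: "finite E1" "card E1 \<le> card E + 2 * card I"
    "E1 \<subseteq> {w. \<forall>i\<in>I. 0 \<le> aff (z i) (s i) w}"
    "convex hull E \<inter> {w. \<forall>i\<in>I. 0 \<le> aff (z i) (s i) w} \<subseteq> convex hull E1" by blast
  obtain E2 where E2: "finite E2" "card E2 \<le> card E1 + 2"
    "E2 \<subseteq> convex hull E1 \<inter> {w. 0 \<le> aff (z j) (s j) w}"
    "convex hull E1 \<inter> {w. 0 \<le> aff (z j) (s j) w} \<subseteq> convex hull E2"
    using polygon_cut[OF E1(1)] by blast
  have "{w. \<forall>i\<in>I. 0 \<le> aff (z i) (s i) w} = (\<Inter>i\<in>I. {w. 0 \<le> aff (z i) (s i) w})" by auto
  then have "convex {w. \<forall>i\<in>I. 0 \<le> aff (z i) (s i) w}"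
    by (simp add: convex_INT convex_aff_nonneg)
  then have "convex hull E1 \<subseteq> {w. \<forall>i\<in>I. 0 \<le> aff (z i) (s i) w}"
    using E1(3) by (simp add: hull_minimal)
  then have "E2 \<subseteq> {w. \<forall>i\<in>insert j I. 0 \<le> aff (z i) (s i) w}"
    using E2(3) by auto
  moreover have "convex hull E \<inter> {w. \<forall>i\<in>insert j I. 0 \<le> aff (z i) (s i) w} \<subseteq> convex hull E2"
    using E1(4) E2(4) by blast
  moreover have "card E2 \<le> card E + 2 * card (insert j I)"
    using E1(2) E2(2) insert.hyps by simp
  ultimately show ?case using E2(1) by blast
qed

text \<open>Replaces a possibly unbounded region by a bounded one: a square contains the finitely
  many points of interest, each being a bilinear combination of its corners.\<close>

lemma finite_subset_quadrilateral:
  fixes W :: "pt set"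
  assumes "finite W"
  shows "\<exists>E. finite E \<and> card E \<le> 4 \<and> E \<noteq> {} \<and> W \<subseteq> convex hull E"
proof -
  obtain R where R: "R > 0" "\<And>w. w \<in> W \<Longrightarrow> norm w \<le> R"
    using finite_imp_bounded[OF assms] bounded_pos by metis
  define v :: "real \<Rightarrow> real \<Rightarrow> pt" where "v a b = (\<chi> i. if i = 1 then a else b)" for a b
  let ?E = "{v R R, v R (- R), v (- R) R, v (- R) (- R)}"
  have "w \<in> convex hull ?E" if "w \<in> W" for w
  proof -
    have w: "\<bar>w$1\<bar> \<le> R" "\<bar>w$2\<bar> \<le> R" using R(2)[OF that] component_le_norm_cart order.trans by blast+
    let ?a = "(w$1 + R) / (2 * R)" and ?b = "(w$2 + R) / (2 * R)"
    have ab: "0 \<le> ?a" "?a \<le> 1" "0 \<le> ?b" "?b \<le> 1" using w R by (auto simp: field_simps)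
    have h: "(1 - ?a) *\<^sub>R v (- R) c + ?a *\<^sub>R v R c = v (w$1) c" for c
      using R(1) by (auto simp: v_def vec_eq_iff field_simps)
    have m: "v (w$1) c \<in> convex hull ?E" if "c = R \<or> c = - R" for c
      unfolding h[symmetric] using that ab by (intro convexD_alt[OF convex_convex_hull]) (auto intro: hull_inc)
    have "(1 - ?b) *\<^sub>R v (w$1) (- R) + ?b *\<^sub>R v (w$1) R \<in> convex hull ?E"
      using m ab by (intro convexD_alt[OF convex_convex_hull]) auto
    also have "(1 - ?b) *\<^sub>R v (w$1) (- R) + ?b *\<^sub>R v (w$1) R = w"
      using R(1) by (auto simp: v_def vec_eq_iff forall_2 field_simps)
    finally show ?thesis .
  qed
  moreover have "card ?E \<le> 4" by (simp add: card_insert_if)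
  ultimately show ?thesis by (intro exI[of _ ?E]) auto
qed

lemma convex_hull_exists_pos:
  assumes "w \<in> convex hull E" "aff z s w > 0"
  shows "\<exists>e\<in>E. aff z s e > 0"
proof (rule ccontr)
  assume "\<not> ?thesis"
  then have "convex hull E \<subseteq> {w. aff z s w \<le> 0}"
    by (intro hull_minimal convex_aff_nonpos) auto
  then show False using assms by auto
qed

lemma convex_hull_exists_neg:
  assumes "w \<in> convex hull E" "aff z s w < 0"
  shows "\<exists>e\<in>E. aff z s e < 0"
proof (rule ccontr)
  assume "\<not> ?thesis"
  then have "convex hull E \<subseteq> {w. aff z s w \<ge> 0}"
    by (intro hull_minimal convex_aff_nonneg) auto
  then show False using assms by auto
qed

lemma aff_perturb:
  assumes "aff z s e > 0"
  obtains \<epsilon> where "0 < \<epsilon>" "\<epsilon> < 1" "aff z s ((1 - \<epsilon>) *\<^sub>R e + \<epsilon> *\<^sub>R w) > 0"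
proof -
  let ?a = "aff z s e" and ?M = "\<bar>aff z s w\<bar> + aff z s e + 1"
  let ?\<epsilon> = "?a / (2 * ?M)"
  have M: "?M > 0" using assms by simp
  have e: "0 < ?\<epsilon>" "?\<epsilon> < 1" using assms M by (auto simp: field_simps)
  have "?\<epsilon> * (?a - aff z s w) \<le> ?\<epsilon> * ?M" using e by (intro mult_left_mono) auto
  also have "\<dots> = ?a / 2" using M by (simp add: field_simps)
  finally have "(1 - ?\<epsilon>) * ?a + ?\<epsilon> * aff z s w > 0" using assms by (simp only: algebra_simps)
  then have "aff z s ((1 - ?\<epsilon>) *\<^sub>R e + ?\<epsilon> *\<^sub>R w) > 0"
    by (subst aff_convex_combination) auto
  then show thesis using that e by blast
qed

lemma aff_uminus: "aff (- z) (- s) w = - aff z s w"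
  by (simp add: aff_def)

text \<open>For finitely many lines a polygon can stand for the open, possibly unbounded
  \<open>C\<close>: choose in \<open>C\<close> a witness on either side of each line where there is
  one, enclose the witnesses in a quadrilateral, and cut it by the \<open>card I\<close> halfplanes,
  each adding at most two vertices. \<open>E\<close> may depend on \<open>U\<close>, since it is
  applied to one finite sample at a time.\<close>

lemma splits_representation:
  fixes z :: "'i \<Rightarrow> pt" and U :: "(pt \<times> real) set"
  assumes "finite I" "finite U"
    and C: "C = {w. \<forall>i\<in>I. 0 < aff (z i) (s i) w}" "C \<noteq> {}"
  shows "\<exists>E. finite E \<and> E \<noteq> {} \<and> card E \<le> 4 + 2 * card I \<and>
    (\<forall>(y, r)\<in>U. splits C (aff y r) \<longleftrightarrow> (\<exists>e\<in>E. aff y r e > 0) \<and> (\<exists>e\<in>E. aff y r e < 0))"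
proof -
  define p where "p u = (SOME w. w \<in> C \<and> (case u of (y, r) \<Rightarrow> aff y r w > 0))" for u
  define q where "q u = (SOME w. w \<in> C \<and> (case u of (y, r) \<Rightarrow> aff y r w < 0))" for u
  have p: "p (y, r) \<in> C" "aff y r (p (y, r)) > 0" if "w \<in> C" "aff y r w > 0" for y r w
    using someI[of "\<lambda>w. w \<in> C \<and> (case (y, r) of (y, r) \<Rightarrow> aff y r w > 0)" w] that by (auto simp: p_def)
  have q: "q (y, r) \<in> C" "aff y r (q (y, r)) < 0" if "w \<in> C" "aff y r w < 0" for y r w
    using someI[of "\<lambda>w. w \<in> C \<and> (case (y, r) of (y, r) \<Rightarrow> aff y r w < 0)" w] that by (auto simp: q_def)
  obtain v where v: "v \<in> C" using C(2) by blast
  \<comment> \<open>A line without a witness leaves \<open>p\<close> or \<open>q\<close> arbitrary;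
    the intersection with \<open>C\<close> discards values outside the region. The point
    \<open>v\<close> keeps \<open>W\<close> nonempty.\<close>
  define W where "W = insert v ((p ` U \<union> q ` U) \<inter> C)"
  have "finite W" using assms(2) by (auto simp: W_def)
  then obtain E0 where E0: "finite E0" "card E0 \<le> 4" "W \<subseteq> convex hull E0"
    using finite_subset_quadrilateral by blast
  obtain E where E: "finite E" "card E \<le> card E0 + 2 * card I"
    "E \<subseteq> {w. \<forall>i\<in>I. 0 \<le> aff (z i) (s i) w}"
    "convex hull E0 \<inter> {w. \<forall>i\<in>I. 0 \<le> aff (z i) (s i) w} \<subseteq> convex hull E"
    using polygon_cuts[OF assms(1) E0(1), of z s] by auto
  have "W \<subseteq> C" using v by (auto simp: W_def)
  moreover have "C \<subseteq> {w. \<forall>i\<in>I. 0 \<le> aff (z i) (s i) w}"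
    unfolding C(1) by (auto simp: less_imp_le)
  ultimately have WE: "W \<subseteq> convex hull E"
    using E(4) E0(3) by blast
  \<comment> \<open>A vertex may lie on the boundary of \<open>C\<close>. A small move towards
    \<open>v\<close>, where all constraints are strict, keeps the sign and makes every constraint
    strict.\<close>
  have inside: "\<exists>w\<in>C. aff y r w > 0" if "e \<in> E" "aff y r e > 0" for e y r
  proof -
    obtain \<epsilon> where ep: "0 < \<epsilon>" "\<epsilon> < 1" "aff y r ((1 - \<epsilon>) *\<^sub>R e + \<epsilon> *\<^sub>R v) > 0"
      using aff_perturb[OF \<open>aff y r e > 0\<close>] by blast
    have "0 < aff (z i) (s i) ((1 - \<epsilon>) *\<^sub>R e + \<epsilon> *\<^sub>R v)" if "i \<in> I" for i
    proof -
      have "0 \<le> aff (z i) (s i) e" "0 < aff (z i) (s i) v"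
        using E(3) \<open>e \<in> E\<close> v C(1) that by auto
      then show ?thesis using ep by (simp add: aff_convex_combination add_nonneg_pos)
    qed
    then show ?thesis using ep(3) C(1) by blast
  qed
  have inside': "\<exists>w\<in>C. aff y r w < 0" if "e \<in> E" "aff y r e < 0" for e y r
    using inside[of e "- y" "- r"] that by (simp add: aff_uminus)
  have "splits C (aff y r) \<longleftrightarrow> (\<exists>e\<in>E. aff y r e > 0) \<and> (\<exists>e\<in>E. aff y r e < 0)" if "(y, r) \<in> U" for y r
  proof
    assume "splits C (aff y r)"
    then have P: "p (y, r) \<in> C" "aff y r (p (y, r)) > 0" "q (y, r) \<in> C" "aff y r (q (y, r)) < 0"
      using p q by (auto simp: splits_def)
    then have "p (y, r) \<in> W" "q (y, r) \<in> W" using that by (auto simp: W_def)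
    then show "(\<exists>e\<in>E. aff y r e > 0) \<and> (\<exists>e\<in>E. aff y r e < 0)"
      using P WE convex_hull_exists_pos convex_hull_exists_neg by blast
  qed (use inside inside' in \<open>auto simp: splits_def\<close>)
  moreover have "E \<noteq> {}" using WE by (auto simp: W_def)
  ultimately show ?thesis using E(1,2) E0(2) by (intro exI[of _ E]) auto
qed

text \<open>A line crosses \<open>aff z s = 0\<close> inside \<open>C\<close> exactly if it takes
  both signs on the chord \<open>L\<close>. The chosen witnesses on the chord span a segment, whose
  two endpoints decide the matter for all of \<open>U\<close>.\<close>

lemma shatters_representation:
  fixes U :: "(pt \<times> real) set"
  assumes "finite U" and C: "convex C" and h: "splits C (aff z s)"
  shows "\<exists>a b. \<forall>(y, r)\<in>U. shatters C (aff y r) (aff z s) \<longleftrightarrow>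
    (\<exists>e\<in>{a, b}. aff y r e > 0) \<and> (\<exists>e\<in>{a, b}. aff y r e < 0)"
proof -
  define L where "L = {w \<in> C. aff z s w = 0}"
  define p where "p u = (SOME w. w \<in> L \<and> (case u of (y, r) \<Rightarrow> aff y r w > 0))" for u
  define q where "q u = (SOME w. w \<in> L \<and> (case u of (y, r) \<Rightarrow> aff y r w < 0))" for u
  have p: "p (y, r) \<in> L" "aff y r (p (y, r)) > 0" if "w \<in> L" "aff y r w > 0" for y r w
    using someI[of "\<lambda>w. w \<in> L \<and> (case (y, r) of (y, r) \<Rightarrow> aff y r w > 0)" w] that by (auto simp: p_def)
  have q: "q (y, r) \<in> L" "aff y r (q (y, r)) < 0" if "w \<in> L" "aff y r w < 0" for y r w
    using someI[of "\<lambda>w. w \<in> L \<and> (case (y, r) of (y, r) \<Rightarrow> aff y r w < 0)" w] that by (auto simp: q_def)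
  obtain f g where fg: "f \<in> C" "g \<in> C" "aff z s f > 0" "aff z s g < 0"
    using h by (auto simp: splits_def)
  obtain l where l: "l \<in> L"
  proof -
    obtain \<alpha> \<beta> where "\<alpha> > 0" "\<beta> > 0" "\<alpha> + \<beta> = 1" "aff z s (\<alpha> *\<^sub>R f + \<beta> *\<^sub>R g) = 0"
      using aff_zero_between[OF fg(3,4)] by blast
    moreover from this have "\<alpha> *\<^sub>R f + \<beta> *\<^sub>R g \<in> C" by (intro convexD[OF C fg(1,2)]) auto
    ultimately show thesis using that by (simp add: L_def)
  qed
  define W where "W = insert l ((p ` U \<union> q ` U) \<inter> L)"
  have W: "finite W" "W \<subseteq> L" "W \<noteq> {}" using assms(1) l by (auto simp: W_def)
  have "z \<noteq> 0" using fg by (auto simp: aff_def)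
  have "convex L"
    using C convex_aff_zero[of z s] unfolding L_def by (metis Collect_conj_eq Collect_mem_eq convex_Int)
  then have hull: "convex hull W \<subseteq> L" using W by (simp add: hull_minimal)
  then have "convex hull W \<subseteq> {w. aff z s w = 0}" by (auto simp: L_def)
  then have "collinear (convex hull W)"
    using collinear_aff_zero[OF \<open>z \<noteq> 0\<close>] collinear_subset by blast
  then obtain a b where ab: "convex hull W = closed_segment a b"
    using compact_convex_collinear_segment[of "convex hull W"] W(1,3)
    by (metis convex_convex_hull convex_hull_eq_empty finite_imp_compact_convex_hull)
  have abL: "a \<in> L" "b \<in> L" using hull ab by auto
  \<comment> \<open>Small moves from \<open>e\<close> towards \<open>f\<close> and towards
    \<open>g\<close>, which lie on opposite sides of the chord, give points with both signs of
    \<open>aff z s\<close> while the sign of \<open>aff y r\<close> is kept.\<close>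
  have push: "splits (half C (aff y r) c) (aff z s)" if "e \<in> L" "c * aff y r e > 0" for e c y r
  proof -
    have c: "aff (c *\<^sub>R y) (c * r) w = c * aff y r w" for w by (simp add: aff_def algebra_simps)
    have step: "\<exists>\<epsilon>>0. \<exists>x\<in>half C (aff y r) c. aff z s x = \<epsilon> * aff z s w" if "w \<in> C" for w
    proof -
      obtain \<epsilon> where ep: "0 < \<epsilon>" "\<epsilon> < 1" "aff (c *\<^sub>R y) (c * r) ((1 - \<epsilon>) *\<^sub>R e + \<epsilon> *\<^sub>R w) > 0"
        using aff_perturb[of "c *\<^sub>R y" "c * r" e] \<open>c * aff y r e > 0\<close> unfolding c by blast
      have "(1 - \<epsilon>) *\<^sub>R e + \<epsilon> *\<^sub>R w \<in> C" using ep \<open>e \<in> L\<close> \<open>w \<in> C\<close> C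
        by (intro convexD_alt) (auto simp: L_def)
      moreover have "aff z s ((1 - \<epsilon>) *\<^sub>R e + \<epsilon> *\<^sub>R w) = \<epsilon> * aff z s w"
        using \<open>e \<in> L\<close> by (simp add: aff_convex_combination L_def)
      ultimately show ?thesis using ep unfolding c half_def by blast
    qed
    show ?thesis
      using step[OF fg(1)] step[OF fg(2)] fg(3,4) unfolding splits_def by (metis mult_pos_neg mult_pos_pos)
  qed
  have "shatters C (aff y r) (aff z s) \<longleftrightarrow>
    (\<exists>e\<in>{a, b}. aff y r e > 0) \<and> (\<exists>e\<in>{a, b}. aff y r e < 0)" if "(y, r) \<in> U" for y r
  proof
    assume "shatters C (aff y r) (aff z s)"
    then obtain f' g' where "f' \<in> L" "aff y r f' > 0" "g' \<in> L" "aff y r g' < 0"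
      using shatters_line_crossed[OF C] unfolding L_def by blast
    then have P: "p (y, r) \<in> L" "aff y r (p (y, r)) > 0" "q (y, r) \<in> L" "aff y r (q (y, r)) < 0"
      using p q by blast+
    then have "p (y, r) \<in> W" "q (y, r) \<in> W" using that by (auto simp: W_def)
    then have "p (y, r) \<in> convex hull {a, b}" "q (y, r) \<in> convex hull {a, b}"
      using hull_inc[of _ W convex] ab by (auto simp: segment_convex_hull)
    then show "(\<exists>e\<in>{a, b}. aff y r e > 0) \<and> (\<exists>e\<in>{a, b}. aff y r e < 0)"
      using P convex_hull_exists_pos convex_hull_exists_neg by blast
  next
    assume "(\<exists>e\<in>{a, b}. aff y r e > 0) \<and> (\<exists>e\<in>{a, b}. aff y r e < 0)"
    then obtain e e' where e: "e \<in> L" "aff y r e > 0" "e' \<in> L" "aff y r e' < 0" using abL by blast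
    then show "shatters C (aff y r) (aff z s)"
      using push[of e 1 y r] push[of e' "- 1" y r] by (simp add: shatters_def)
  qed
  then show ?thesis by blast
qed

section \<open>The learner and its mistakes\<close>

definition weight :: "nat \<Rightarrow> pt set \<Rightarrow> (nat \<Rightarrow> pt \<Rightarrow> real) \<Rightarrow> nat \<Rightarrow> nat \<Rightarrow> nat" where
  "weight N C G t a = (if splits C (G a) then N + card {u. u < t \<and> shatters C (G u) (G a)} else 0)"

text \<open>Crossings enter as ordered pairs, so two past lines that cross in \<open>C\<close>
  contribute 2.\<close>

definition potential :: "nat \<Rightarrow> pt set \<Rightarrow> (nat \<Rightarrow> pt \<Rightarrow> real) \<Rightarrow> nat \<Rightarrow> nat" where
  "potential N C G t = (\<Sum>a<t. weight N C G t a)"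

lemma weight_mono:
  assumes "C \<subseteq> C'"
  shows "weight N C G t a \<le> weight N C' G t a"
proof -
  have "card {u. u < t \<and> shatters C (G u) (G a)} \<le> card {u. u < t \<and> shatters C' (G u) (G a)}"
    using assms by (intro card_mono) (auto intro: shatters_mono)
  then show ?thesis using assms by (auto simp: weight_def intro: splits_mono)
qed

text \<open>The new line raises each of the \<open>t\<close> older weights by at most one and brings
  its own weight, at most \<open>N + t + 1\<close>.\<close>

lemma potential_Suc: "potential N C G (Suc t) \<le> potential N C G t + (N + 2 * t + 1)"
proof -
  have "weight N C G (Suc t) a \<le> weight N C G t a + 1" for a
  proof -
    have "card {u. u < Suc t \<and> shatters C (G u) (G a)} \<le> card (insert t {u. u < t \<and> shatters C (G u) (G a)})"
      by (intro card_mono) (auto simp: less_Suc_eq)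
    also have "\<dots> \<le> card {u. u < t \<and> shatters C (G u) (G a)} + 1"
      by (simp add: card_insert_if)
    finally show ?thesis by (simp add: weight_def)
  qed
  then have "(\<Sum>a<t. weight N C G (Suc t) a) \<le> (\<Sum>a<t. weight N C G t a + 1)"
    by (rule sum_mono)
  moreover have "card {u. u < Suc t \<and> shatters C (G u) (G t)} \<le> card {..<Suc t}"
    by (intro card_mono) auto
  then have "weight N C G (Suc t) t \<le> N + Suc t"
    by (simp add: weight_def)
  ultimately show ?thesis by (simp add: potential_def sum.distrib del: add_Suc_right One_nat_def)
qed

text \<open>If the cut does not cross \<open>a\<close> inside \<open>C\<close>, one half loses the
  whole weight of \<open>a\<close>, which is at least \<open>N\<close>. If it does, both halves keep
  the base \<open>N\<close>, but each of the \<open>k\<close> crossings on \<open>a\<close> survives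
  in at most one half, so the halves sum to at most \<open>2 * N + k\<close>, and in this case
  \<open>k \<ge> N\<close>.\<close>

lemma weight_halves:
  assumes C: "convex C"
    and a: "splits C (aff y r)" "\<not> (shatters C (aff z s) (aff y r) \<and> card {u. u < t \<and> shatters C (aff (x u) (c u)) (aff y r)} < N)"
    and G: "G = (\<lambda>u. aff (x u) (c u))" "G a = aff y r"
  shows "weight N (half C (aff z s) 1) G t a + weight N (half C (aff z s) (- 1)) G t a + N \<le> 2 * weight N C G t a"
proof (cases "shatters C (aff z s) (aff y r)")
  case False
  then have "weight N (half C (aff z s) 1) G t a = 0 \<or> weight N (half C (aff z s) (- 1)) G t a = 0"
    by (auto simp: shatters_def weight_def G(2))
  moreover have "weight N (half C (aff z s) e) G t a \<le> weight N C G t a" for e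
    by (intro weight_mono half_subset)
  then have "weight N (half C (aff z s) 1) G t a \<le> weight N C G t a" "weight N (half C (aff z s) (- 1)) G t a \<le> weight N C G t a" by blast+
  moreover have "N \<le> weight N C G t a" using a(1) by (simp add: weight_def G(2))
  ultimately show ?thesis by linarith
next
  case True
  let ?S = "\<lambda>C. {u. u < t \<and> shatters C (G u) (G a)}"
  have "card (?S (half C (aff z s) 1)) + card (?S (half C (aff z s) (- 1))) =
      card (?S (half C (aff z s) 1) \<union> ?S (half C (aff z s) (- 1)))"
    using not_shatters_both_sides[OF C] unfolding G(2) by (intro card_Un_disjoint[symmetric]) (auto simp: G(1))
  also have "\<dots> \<le> card (?S C)"
    by (intro card_mono) (auto intro: shatters_mono[OF _ half_subset])
  finally have "card (?S (half C (aff z s) 1)) + card (?S (half C (aff z s) (- 1))) \<le> card (?S C)" .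
  moreover have "card (?S C) \<ge> N" using a(2) True unfolding G(2) by (simp add: G(1))
  moreover have "splits (half C (aff z s) 1) (G a)" "splits (half C (aff z s) (- 1)) (G a)" "splits C (G a)"
    using True a(1) by (auto simp: shatters_def G(2))
  ultimately show ?thesis by (simp add: weight_def)
qed

text \<open>Let \<open>A\<close> be the past lines crossing \<open>C\<close>, and \<open>B\<close>
  those among them that the cut crosses and that have fewer than \<open>N\<close> crossings. Each
  line of \<open>A - B\<close> costs the two halves together at least \<open>N\<close>, while each
  half loses less than \<open>N\<^sup>2 / 4\<close>. Hence \<open>card (A - B) < N / 2\<close>, and
  \<open>B\<close> is more than half of \<open>A\<close> once \<open>card A \<ge> N\<close>.\<close>

lemma small_potential_drop:
  assumes C: "convex C"
    and G: "G = (\<lambda>u. aff (x u) (c u))"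
    and drop: "4 * potential N C G t < 4 * potential N (half C (aff z s) 1) G t + N\<^sup>2"
      "4 * potential N C G t < 4 * potential N (half C (aff z s) (- 1)) G t + N\<^sup>2"
  shows "card {a. a < t \<and> splits C (G a)} < N \<or>
    card {a. a < t \<and> splits C (G a)} \<le>
      4 * card {a. a < t \<and> splits C (G a) \<and> shatters C (aff z s) (G a) \<and>
        card {u. u < t \<and> shatters C (G u) (G a)} < N}"
proof -
  define A where "A = {a. a < t \<and> splits C (G a)}"
  define B where "B = {a. a < t \<and> splits C (G a) \<and> shatters C (aff z s) (G a) \<and> card {u. u < t \<and> shatters C (G u) (G a)} < N}"
  have fin: "finite A" "finite B" "B \<subseteq> A" by (auto simp: A_def B_def)
  let ?p = "weight N (half C (aff z s) 1) G t" and ?m = "weight N (half C (aff z s) (- 1)) G t"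
  have "(\<Sum>a<t. ?p a + ?m a + (if a \<in> A - B then N else 0)) \<le> (\<Sum>a<t. 2 * weight N C G t a)"
  proof (rule sum_mono)
    fix a assume a: "a \<in> {..<t}"
    show "?p a + ?m a + (if a \<in> A - B then N else 0) \<le> 2 * weight N C G t a"
    proof (cases "a \<in> A - B")
      case True
      then have "?p a + ?m a + N \<le> 2 * weight N C G t a"
        using a by (intro weight_halves[OF C _ _ G]) (auto simp: A_def B_def G)
      then show ?thesis using True by simp
    next
      case False
      have "weight N (half C (aff z s) e) G t a \<le> weight N C G t a" for e
        by (intro weight_mono half_subset)
      from this[of 1] this[of "- 1"] False show ?thesis by (simp only: if_False)
    qed
  qed
  moreover have "(\<Sum>a<t. if a \<in> A - B then N else 0) = N * card (A - B)"
  proof -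
    have "(\<Sum>a<t. if a \<in> A - B then N else 0) = (\<Sum>a\<in>{a \<in> {..<t}. a \<in> A - B}. N)"
      by (rule sum.inter_filter[symmetric]) simp
    also have "{a \<in> {..<t}. a \<in> A - B} = A - B" by (auto simp: A_def)
    finally show ?thesis by simp
  qed
  ultimately have "potential N (half C (aff z s) 1) G t + potential N (half C (aff z s) (- 1)) G t + N * card (A - B)
      \<le> 2 * potential N C G t"
    by (simp only: potential_def sum.distrib sum_distrib_left)
  then have "4 * (N * card (A - B)) < 2 * N\<^sup>2" using drop by linarith
  then have "N * (2 * card (A - B)) < N * N" by (simp add: power2_eq_square)
  then have "2 * card (A - B) < N" by (simp only: mult_less_cancel1)
  moreover have "card (A - B) = card A - card B" "card B \<le> card A"
    using fin by (auto intro: card_Diff_subset card_mono)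
  ultimately have "card A < N \<or> card A \<le> 4 * card B" by linarith
  then show ?thesis by (simp add: A_def B_def)
qed

text \<open>With \<open>e\<close> the first round and the target scaled so that
  \<open>w \<bullet> fst e + b\<close> equals its label, this is \<open>w \<bullet> u + b\<close> as
  a function of \<open>w\<close> alone.\<close>

definition lin :: "lent \<Rightarrow> pt \<Rightarrow> pt \<Rightarrow> real" where
  "lin e u = aff (u - fst e) (real_of_int (fst (snd e)))"

definition mistake :: "lent \<Rightarrow> bool" where
  "mistake e \<longleftrightarrow> snd (snd e) \<noteq> None \<and> snd (snd e) \<noteq> Some (fst (snd e))"

text \<open>Only erroneous rounds impose constraints, so the number of vertices obtained from
  \<open>splits_representation\<close> is controlled by the number of mistakes.\<close>

definition version_space :: "nat \<Rightarrow> (nat \<Rightarrow> lent) \<Rightarrow> pt set" where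
  "version_space t v = {w. \<forall>i<t. mistake (v i) \<longrightarrow> 0 < real_of_int (fst (snd (v i))) * lin (v 0) (fst (v i)) w}"

text \<open>Round 0 has no earlier entry to normalise by, hence the fixed guess. A line that does
  not split \<open>C\<close> receives the sign that occurs. Otherwise the answer is a label whose
  refutation would lower the potential by at least \<open>N\<^sup>2 / 4\<close>, if there is
  one.\<close>

definition predict :: "nat \<Rightarrow> nat \<Rightarrow> (nat \<Rightarrow> lent) \<Rightarrow> pt \<Rightarrow> int option" where
  "predict N t v x =
    (let C = version_space t v; G = (\<lambda>i. lin (v 0) (fst (v i))); g = lin (v 0) x in
     if t = 0 then Some 1
     else if \<not> splits C g then Some (if \<exists>w\<in>C. g w > 0 then 1 else - 1)
     else if 4 * potential N (half C g 1) G t + N\<^sup>2 \<le> 4 * potential N C G t then Some (- 1)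
     else if 4 * potential N (half C g (- 1)) G t + N\<^sup>2 \<le> 4 * potential N C G t then Some 1
     else None)"

definition labelled :: "pt \<Rightarrow> real \<Rightarrow> nat \<Rightarrow> (nat \<Rightarrow> lent) \<Rightarrow> bool" where
  "labelled w b t v \<longleftrightarrow> (\<forall>i<t. fst (snd (v i)) = halfspace w b (fst (v i)))"

definition followed :: "nat \<Rightarrow> nat \<Rightarrow> (nat \<Rightarrow> lent) \<Rightarrow> bool" where
  "followed N t v \<longleftrightarrow> (\<forall>i<t. snd (snd (v i)) = predict N i v (fst (v i)))"

section \<open>Consistency of the version space and the mistake bound\<close>

lemma halfspace_cases: "halfspace w b x = 1 \<or> halfspace w b x = - 1"
  by (simp add: halfspace_def sgn_pm_def)

text \<open>As \<open>sgn_pm 0 = 1\<close>, only boundary points need care. Raising \<open>b\<close>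
  by at most half the least absolute value among the negative points makes them strictly positive
  and leaves the negative ones negative.\<close>

lemma halfspace_strict:
  assumes "finite X"
  shows "\<exists>b'. \<forall>u\<in>X. real_of_int (halfspace w b u) * (w \<bullet> u + b') > 0"
proof -
  let ?S = "insert 1 ((\<lambda>u. - (w \<bullet> u + b)) ` {u \<in> X. w \<bullet> u + b < 0})"
  have S: "finite ?S" "?S \<noteq> {}" using assms by auto
  then have pos: "Min ?S > 0" by (subst Min_gr_iff) auto
  have "Min ?S \<le> - (w \<bullet> u + b)" if "u \<in> X" "w \<bullet> u + b < 0" for u
    using that S by (intro Min_le) auto
  then show ?thesis
    using pos by (intro exI[of _ "b + Min ?S / 2"]) (fastforce simp: halfspace_def sgn_pm_def)
qed

text \<open>Dividing a strict separator by its margin \<open>c\<close> at the first point makes its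
  value there exactly the first label, which is the normalisation built into
  \<open>lin\<close>.\<close>

lemma strict_target:
  assumes "finite X" "fst (snd e) = halfspace w b (fst e)"
  shows "\<exists>w'. \<forall>u\<in>X. real_of_int (halfspace w b u) * lin e u w' > 0"
proof -
  let ?y = "real_of_int (halfspace w b (fst e))"
  obtain b' where b': "\<And>u. u \<in> insert (fst e) X \<Longrightarrow> real_of_int (halfspace w b u) * (w \<bullet> u + b') > 0"
    using halfspace_strict[of "insert (fst e) X"] assms(1) by blast
  define c where "c = ?y * (w \<bullet> fst e + b')"
  have c: "c > 0" using b' by (simp add: c_def)
  have y: "?y * ?y = 1" using halfspace_cases[of w b "fst e"] by auto
  have lin: "lin e u ((1 / c) *\<^sub>R w) = (w \<bullet> u + b') / c" for u
  proof -
    have "w \<bullet> fst e + b' = ?y * c" using y by (simp add: c_def flip: mult.assoc)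
    then have "w \<bullet> u - w \<bullet> fst e = (w \<bullet> u + b') - ?y * c" by simp
    then have "(w \<bullet> u - w \<bullet> fst e) / c = (w \<bullet> u + b') / c - ?y"
      using c by (simp only: diff_divide_distrib) simp
    then have "(w \<bullet> u - w \<bullet> fst e) / c + ?y = (w \<bullet> u + b') / c" by simp
    then show ?thesis by (simp add: lin_def aff_def assms(2) inner_diff_right diff_divide_distrib)
  qed
  have "real_of_int (halfspace w b u) * lin e u ((1 / c) *\<^sub>R w) > 0" if "u \<in> X" for u
    unfolding lin using b'[of u] that c by (simp add: zero_less_divide_iff)
  then show ?thesis by blast
qed

text \<open>Applies \<open>strict_target\<close> to the past points and \<open>x\<close> together.
  So the version space is nonempty and the true label of \<open>x\<close> is among the signs that
  occur on it.\<close>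

lemma labelled_target:
  assumes "labelled w b t v" "t > 0"
  shows "\<exists>w'. w' \<in> version_space t v \<and> real_of_int (halfspace w b x) * lin (v 0) x w' > 0"
proof -
  obtain w' where "\<forall>u\<in>insert x ((\<lambda>i. fst (v i)) ` {..<t}). real_of_int (halfspace w b u) * lin (v 0) u w' > 0"
    using strict_target[of "insert x ((\<lambda>i. fst (v i)) ` {..<t})" "v 0" w b] assms by (auto simp: labelled_def)
  then show ?thesis using assms(1) by (auto simp: version_space_def labelled_def)
qed

lemma version_space_Suc:
  "version_space (Suc t) v = (if mistake (v t)
     then half (version_space t v) (lin (v 0) (fst (v t))) (real_of_int (fst (snd (v t)))) else version_space t v)"
  by (auto simp: version_space_def half_def less_Suc_eq)

text \<open>On a line that does not split the region the prediction agrees with the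
  \<open>w'\<close> of \<open>labelled_target\<close>. An error therefore comes from one of the two
  potential tests, and the true label selects the half on which that test found the drop.\<close>

lemma mistake_potential_drop:
  assumes lab: "labelled w b (Suc t) v" and fol: "followed N (Suc t) v" and t: "t > 0" and m: "mistake (v t)"
  shows "4 * potential N (version_space (Suc t) v) (\<lambda>i. lin (v 0) (fst (v i))) t + N\<^sup>2
    \<le> 4 * potential N (version_space t v) (\<lambda>i. lin (v 0) (fst (v i))) t"
proof -
  let ?C = "version_space t v" and ?g = "lin (v 0) (fst (v t))" and ?y = "fst (snd (v t))"
  have y: "?y = halfspace w b (fst (v t))" using lab by (simp add: labelled_def)
  have p: "snd (snd (v t)) = predict N t v (fst (v t))" using fol by (simp add: followed_def)
  have "labelled w b t v" using lab by (simp add: labelled_def)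
  then obtain w' where w': "w' \<in> ?C" "real_of_int ?y * ?g w' > 0"
    using labelled_target[OF _ t, of w b v "fst (v t)"] y by auto
  have yc: "?y = 1 \<or> ?y = - 1" using y halfspace_cases by metis
  have sp: "splits ?C ?g"
  proof (rule ccontr)
    assume ns: "\<not> splits ?C ?g"
    then have "predict N t v (fst (v t)) = Some (if \<exists>w\<in>?C. ?g w > 0 then 1 else - 1)"
      using t by (simp add: predict_def)
    moreover have "(\<exists>w\<in>?C. ?g w > 0) \<longleftrightarrow> ?y = 1"
      using yc w' ns by (auto simp: splits_def)
    ultimately show False using m p yc by (auto simp: mistake_def split: if_splits)
  qed
  have C: "version_space (Suc t) v = half ?C ?g (real_of_int ?y)" using m by (simp add: version_space_Suc)
  show ?thesis
    unfolding C using m p yc sp t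
    by (auto simp: mistake_def predict_def Let_def split: if_splits)
qed

text \<open>Amortisation: a round raises the potential by at most \<open>N + 2 * T\<close>, and a
  later mistake lowers it by at least \<open>N\<^sup>2 / 4\<close>. The extra
  \<open>N\<^sup>2\<close> pays for a wrong guess in round 0.\<close>

lemma mistakes_bound:
  assumes "labelled w b t v" "followed N t v" "0 < t" "t \<le> T"
  shows "N\<^sup>2 * card {i. i < t \<and> mistake (v i)} + 4 * potential N (version_space t v) (\<lambda>i. lin (v 0) (fst (v i))) t
    \<le> N\<^sup>2 + 4 * t * (N + 2 * T)"
  using assms(3,1,2,4)
proof (induction t rule: nat_induct_non_zero)
  case 1
  have "card {i. i < 1 \<and> mistake (v i)} \<le> card {0::nat}" by (intro card_mono) auto
  then have "N\<^sup>2 * card {i. i < 1 \<and> mistake (v i)} \<le> N\<^sup>2 * 1" by (intro mult_left_mono) auto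
  moreover have "4 * potential N (version_space 1 v) (\<lambda>i. lin (v 0) (fst (v i))) 1 \<le> 4 * (N + 2 * T)"
    using potential_Suc[of N "version_space 1 v" "\<lambda>i. lin (v 0) (fst (v i))" 0] 1(3) by (simp add: potential_def)
  ultimately show ?case by (simp only: mult_1_right)
next
  case (Suc t)
  let ?G = "\<lambda>i. lin (v 0) (fst (v i))"
  have IH: "N\<^sup>2 * card {i. i < t \<and> mistake (v i)} + 4 * potential N (version_space t v) ?G t
    \<le> N\<^sup>2 + 4 * t * (N + 2 * T)"
    using Suc by (auto simp: labelled_def followed_def)
  have S: "potential N (version_space (Suc t) v) ?G (Suc t) \<le> potential N (version_space (Suc t) v) ?G t + (N + 2 * T)"
    using potential_Suc[of N "version_space (Suc t) v" ?G t] Suc.prems(3) by simp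
  show ?case
  proof (cases "mistake (v t)")
    case True
    have "{i. i < Suc t \<and> mistake (v i)} = insert t {i. i < t \<and> mistake (v i)}"
      using True by (auto simp: less_Suc_eq)
    then have "card {i. i < Suc t \<and> mistake (v i)} = Suc (card {i. i < t \<and> mistake (v i)})" by simp
    then show ?thesis
      using IH S mistake_potential_drop[OF Suc.prems(1,2) Suc.hyps True] by (simp add: algebra_simps)
  next
    case False
    then have "{i. i < Suc t \<and> mistake (v i)} = {i. i < t \<and> mistake (v i)}"
      by (auto simp: less_Suc_eq)
    then show ?thesis
      using IH S False by (simp add: version_space_Suc algebra_simps)
  qed
qed

lemma convex_version_space: "convex (version_space t v)"
proof -
  have "version_space t v = (\<Inter>i\<in>{i. i < t \<and> mistake (v i)}.
      {w. 0 < aff (real_of_int (fst (snd (v i))) *\<^sub>R (fst (v i) - fst (v 0)))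
        (real_of_int (fst (snd (v i))) * real_of_int (fst (snd (v 0)))) w})"
    by (auto simp: version_space_def lin_def aff_def algebra_simps)
  then show ?thesis by (simp add: convex_INT convex_aff_pos)
qed

lemma version_space_splits_representation:
  assumes "labelled w b t v" "t > 0" "finite U"
  shows "\<exists>E. finite E \<and> E \<noteq> {} \<and> card E \<le> 4 + 2 * card {i. i < t \<and> mistake (v i)} \<and>
    (\<forall>u\<in>U. splits (version_space t v) (lin (v 0) u) \<longleftrightarrow> (\<exists>e\<in>E. lin (v 0) u e > 0) \<and> (\<exists>e\<in>E. lin (v 0) u e < 0))"
proof -
  have V: "version_space t v = {w. \<forall>i\<in>{i. i < t \<and> mistake (v i)}.
      0 < aff (real_of_int (fst (snd (v i))) *\<^sub>R (fst (v i) - fst (v 0)))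
        (real_of_int (fst (snd (v i))) * real_of_int (fst (snd (v 0)))) w}"
    by (auto simp: version_space_def lin_def aff_def algebra_simps)
  have "version_space t v \<noteq> {}" using labelled_target[OF assms(1,2)] by blast
  then show ?thesis
    using splits_representation[OF _ _ V, of "(\<lambda>u. (u - fst (v 0), real_of_int (fst (snd (v 0))))) ` U"] assms(3)
    by (simp add: lin_def)
qed

lemma version_space_shatters_representation:
  assumes "finite U" "splits (version_space t v) (lin (v 0) x)"
  shows "\<exists>E. finite E \<and> E \<noteq> {} \<and> card E \<le> 2 \<and>
    (\<forall>u\<in>U. shatters (version_space t v) (lin (v 0) u) (lin (v 0) x) \<longleftrightarrow>
      (\<exists>e\<in>E. lin (v 0) u e > 0) \<and> (\<exists>e\<in>E. lin (v 0) u e < 0))"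
proof -
  obtain p q where pq: "\<forall>u\<in>U. shatters (version_space t v) (lin (v 0) u) (lin (v 0) x) \<longleftrightarrow>
      (\<exists>e\<in>{p, q}. lin (v 0) u e > 0) \<and> (\<exists>e\<in>{p, q}. lin (v 0) u e < 0)"
    using shatters_representation[of "(\<lambda>u. (u - fst (v 0), real_of_int (fst (snd (v 0))))) ` U"
        "version_space t v" "x - fst (v 0)" "real_of_int (fst (snd (v 0)))"]
      assms convex_version_space by (auto simp: lin_def)
  have "card {p, q} \<le> 2" by (simp add: card_insert_if)
  then show ?thesis using pq by (intro exI[of _ "{p, q}"]) auto
qed

lemma predict_None:
  assumes "predict N t v x = None"
  defines "C \<equiv> version_space t v" and "G \<equiv> \<lambda>i. lin (v 0) (fst (v i))"
  shows "t > 0" "splits C (lin (v 0) x)"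
    "card {a. a < t \<and> splits C (G a)} < N \<or>
      card {a. a < t \<and> splits C (G a)} \<le>
        4 * card {a. a < t \<and> splits C (G a) \<and> shatters C (lin (v 0) x) (G a) \<and>
          card {u. u < t \<and> shatters C (G u) (G a)} < N}"
proof -
  have *: "t > 0 \<and> splits C (lin (v 0) x) \<and>
    4 * potential N C G t < 4 * potential N (half C (lin (v 0) x) 1) G t + N\<^sup>2 \<and>
    4 * potential N C G t < 4 * potential N (half C (lin (v 0) x) (- 1)) G t + N\<^sup>2"
    using assms(1) by (auto simp: predict_def C_def G_def Let_def split: if_splits)
  then show "t > 0" "splits C (lin (v 0) x)" by auto
  show "card {a. a < t \<and> splits C (G a)} < N \<or>
      card {a. a < t \<and> splits C (G a)} \<le>
        4 * card {a. a < t \<and> splits C (G a) \<and> shatters C (lin (v 0) x) (G a) \<and>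
          card {u. u < t \<and> shatters C (G u) (G a)} < N}"
    using * small_potential_drop[of C G "\<lambda>u. fst (v u) - fst (v 0)" "\<lambda>_. real_of_int (fst (snd (v 0)))" N t
        "x - fst (v 0)" "real_of_int (fst (snd (v 0)))"] convex_version_space
    by (simp add: C_def G_def lin_def)
qed

section \<open>Measurability and deviation of ghost samples\<close>

text \<open>The witnesses form an open set, so a countable dense set contains one whenever any
  exists. This turns quantifiers over the plane into countable ones.\<close>

lemma pred_exists_open:
  fixes P :: "'a \<Rightarrow> 'b::second_countable_topology \<Rightarrow> bool"
  assumes "\<And>x. open {w. P x w}" "\<And>w. Measurable.pred M (\<lambda>x. P x w)"
  shows "Measurable.pred M (\<lambda>x. \<exists>w. P x w)"
proof -
  obtain Q :: "'b set" where Q: "countable Q" "\<And>X. open X \<Longrightarrow> X \<noteq> {} \<Longrightarrow> \<exists>d\<in>Q. d \<in> X"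
    using countable_dense_setE by blast
  have "(\<exists>w. P x w) \<longleftrightarrow> (\<exists>w\<in>Q. P x w)" for x
    using Q(2)[OF assms(1)[of x]] by auto
  moreover have "Measurable.pred M (\<lambda>x. \<exists>w\<in>Q. P x w)"
    using assms(2) Q(1) by (simp add: pred_def sets.sets_Collect_countable_Bex)
  ultimately show ?thesis by simp
qed

definition random_open :: "'a measure \<Rightarrow> ('a \<Rightarrow> pt set) \<Rightarrow> bool" where
  "random_open M R \<longleftrightarrow> (\<forall>x. open (R x)) \<and> (\<forall>w. Measurable.pred M (\<lambda>x. w \<in> R x))"

definition random_continuous :: "'a measure \<Rightarrow> ('a \<Rightarrow> pt \<Rightarrow> real) \<Rightarrow> bool" where
  "random_continuous M g \<longleftrightarrow> (\<forall>x. continuous_on UNIV (g x)) \<and> (\<forall>w. (\<lambda>x. g x w) \<in> borel_measurable M)"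

lemma random_open_half:
  assumes "random_open M R" "random_continuous M g"
  shows "random_open M (\<lambda>x. half (R x) (g x) s)"
proof -
  have [measurable]: "Measurable.pred M (\<lambda>x. w \<in> R x)" "(\<lambda>x. g x w) \<in> borel_measurable M" for w
    using assms by (auto simp: random_open_def random_continuous_def)
  have "open (half (R x) (g x) s)" for x
  proof -
    have "open {w. 0 < s * g x w}"
      using assms(2) by (intro open_Collect_less continuous_intros) (auto simp: random_continuous_def)
    moreover have "half (R x) (g x) s = R x \<inter> {w. 0 < s * g x w}" by (auto simp: half_def)
    ultimately show ?thesis using assms(1) by (auto simp: random_open_def)
  qed
  moreover have "Measurable.pred M (\<lambda>x. w \<in> half (R x) (g x) s)" for w
    unfolding half_def mem_Collect_eq by measurable
  ultimately show ?thesis by (simp add: random_open_def)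
qed

lemma pred_exists_random_open:
  assumes "random_open M R"
  shows "Measurable.pred M (\<lambda>x. \<exists>w. w \<in> R x)"
  using assms by (intro pred_exists_open) (auto simp: random_open_def)

lemma pred_exists_pos:
  assumes "random_open M R" "random_continuous M g"
  shows "Measurable.pred M (\<lambda>x. \<exists>w\<in>R x. g x w > 0)"
proof -
  have "(\<exists>w\<in>R x. g x w > 0) \<longleftrightarrow> (\<exists>w. w \<in> half (R x) (g x) 1)" for x by (auto simp: half_def)
  then show ?thesis using pred_exists_random_open[OF random_open_half[OF assms]] by simp
qed

lemma pred_splits:
  assumes "random_open M R" "random_continuous M g"
  shows "Measurable.pred M (\<lambda>x. splits (R x) (g x))"
proof -
  have "splits (R x) (g x) \<longleftrightarrow> (\<exists>w. w \<in> half (R x) (g x) 1) \<and> (\<exists>w. w \<in> half (R x) (g x) (- 1))" for x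
    by (auto simp: half_def splits_def)
  then show ?thesis using pred_exists_random_open[OF random_open_half[OF assms]] by simp
qed

lemma pred_shatters:
  assumes "random_open M R" "random_continuous M g" "random_continuous M h"
  shows "Measurable.pred M (\<lambda>x. shatters (R x) (g x) (h x))"
  unfolding shatters_def using assms
  by (intro pred_intros_logic pred_splits random_open_half)

lemma borel_measurable_potential:
  assumes R: "random_open M R" and G: "\<And>i. i < t \<Longrightarrow> random_continuous M (\<lambda>x. G x i)"
  shows "(\<lambda>x. real (potential N (R x) (G x) t)) \<in> borel_measurable M"
proof -
  have "real (potential N (R x) (G x) t) =
      (\<Sum>a<t. if splits (R x) (G x a) then real N + (\<Sum>u<t. if shatters (R x) (G x u) (G x a) then 1 else 0) else 0)" for x
  proof -
    have "real (card {u. u < t \<and> shatters (R x) (G x u) (G x a)}) = (\<Sum>u<t. if shatters (R x) (G x u) (G x a) then 1 else 0)" for a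
    proof -
      have "real (card {u. u < t \<and> shatters (R x) (G x u) (G x a)}) = (\<Sum>u\<in>{u \<in> {..<t}. shatters (R x) (G x u) (G x a)}. 1)"
        by simp
      then show ?thesis by (subst (asm) sum.inter_filter) auto
    qed
    then show ?thesis unfolding potential_def weight_def of_nat_sum by (intro sum.cong) auto
  qed
  moreover have [measurable]: "Measurable.pred M (\<lambda>x. splits (R x) (G x a))"
    "Measurable.pred M (\<lambda>x. shatters (R x) (G x u) (G x a))" if "a < t" "u < t" for a u
    using that R G by (auto intro!: pred_splits pred_shatters)
  ultimately show ?thesis by (auto intro!: borel_measurable_sum measurable_If)
qed

lemma random_continuous_lin:
  assumes "(\<lambda>x. fst (e x)) \<in> borel_measurable M" "(\<lambda>x. fst (snd (e x))) \<in> measurable M (count_space UNIV)"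
    and "u \<in> borel_measurable M"
  shows "random_continuous M (\<lambda>x. lin (e x) (u x))"
proof -
  note [measurable] = assms
  have "(\<lambda>x. real_of_int (fst (snd (e x)))) \<in> borel_measurable M"
    using assms(2) by measurable
  then have "(\<lambda>x. lin (e x) (u x) w) \<in> borel_measurable M" for w
    unfolding lin_def aff_def by measurable
  moreover have "continuous_on UNIV (lin (e x) (u x))" for x
    unfolding lin_def aff_def by (intro continuous_intros)
  ultimately show ?thesis by (simp add: random_continuous_def)
qed

text \<open>Every test in \<open>predict\<close> reduces to whether some random open set is
  nonempty; the version space is open because its constraints are strict.\<close>

lemma measurable_predict:
  "(\<lambda>(v, x). predict N t v x) \<in> measurable (lhistM \<Otimes>\<^sub>M (borel :: pt measure)) (count_space UNIV)"
proof -
  let ?M = "lhistM \<Otimes>\<^sub>M (borel :: pt measure)"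
  have ev: "(\<lambda>z. fst z i) \<in> measurable ?M lentM" for i
    unfolding lhistM_def by measurable
  have x [measurable]: "(\<lambda>z. fst (fst z i)) \<in> borel_measurable ?M" for i
    using ev[of i] unfolding lentM_def by measurable
  have yp: "(\<lambda>z. snd (fst z i)) \<in> measurable ?M (count_space UNIV)" for i
    using ev[of i] unfolding lentM_def by measurable
  have y [measurable]: "(\<lambda>z. fst (snd (fst z i))) \<in> measurable ?M (count_space UNIV)" for i
    using yp[of i] by (rule measurable_compose) simp
  have m [measurable]: "Measurable.pred ?M (\<lambda>z. mistake (fst z i))" for i
  proof -
    have "(\<lambda>a. snd a \<noteq> None \<and> snd a \<noteq> Some (fst a)) \<in> measurable (count_space UNIV) (count_space (UNIV :: bool set))"
      by simp
    from measurable_compose[OF yp[of i] this] show ?thesis unfolding mistake_def .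
  qed
  have yr [measurable]: "(\<lambda>z. real_of_int (fst (snd (fst z i)))) \<in> borel_measurable ?M" for i
    by measurable
  have G: "random_continuous ?M (\<lambda>z. lin (fst z 0) (fst (fst z i)))" for i
    by (rule random_continuous_lin) measurable
  have g: "random_continuous ?M (\<lambda>z. lin (fst z 0) (snd z))"
    by (rule random_continuous_lin) measurable
  have C: "random_open ?M (\<lambda>z. version_space t (fst z))"
  proof -
    have [measurable]: "(\<lambda>z. lin (fst z 0) (fst (fst z i)) w) \<in> borel_measurable ?M" for i w
      using G by (simp add: random_continuous_def)
    have "Measurable.pred ?M (\<lambda>z. w \<in> version_space t (fst z))" for w
      unfolding version_space_def mem_Collect_eq by measurable
    moreover have "open (version_space t v)" for v
    proof -
      have "version_space t v = (\<Inter>i\<in>{i. i < t \<and> mistake (v i)}.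
          {w. 0 < real_of_int (fst (snd (v i))) * lin (v 0) (fst (v i)) w})"
        by (auto simp: version_space_def)
      moreover have "open {w. 0 < real_of_int (fst (snd (v i))) * lin (v 0) (fst (v i)) w}" for i
        unfolding lin_def aff_def by (intro open_Collect_less continuous_intros)
      ultimately show ?thesis by auto
    qed
    ultimately show ?thesis by (simp add: random_open_def)
  qed
  note [measurable] = pred_splits[OF C g] pred_exists_pos[OF C g]
    borel_measurable_potential[OF C, of t "\<lambda>z i. lin (fst z 0) (fst (fst z i))" N, OF G]
    borel_measurable_potential[OF random_open_half[OF C g], of t "\<lambda>z i. lin (fst z 0) (fst (fst z i))" N, OF G]
  \<comment> \<open>The comparison of naturals is moved to the reals, where the potentials are known
    to be Borel.\<close>
  have le: "4 * a + N\<^sup>2 \<le> 4 * b \<longleftrightarrow> 4 * real a + (real N)\<^sup>2 \<le> 4 * real b" for a b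
  proof -
    have "4 * a + N\<^sup>2 \<le> 4 * b \<longleftrightarrow> real (4 * a + N\<^sup>2) \<le> real (4 * b)" by (simp only: of_nat_le_iff)
    then show ?thesis by simp
  qed
  have drop: "Measurable.pred ?M (\<lambda>z. 4 * real (potential N (half (version_space t (fst z)) (lin (fst z 0) (snd z)) s)
      (\<lambda>i. lin (fst z 0) (fst (fst z i))) t) + (real N)\<^sup>2
    \<le> 4 * real (potential N (version_space t (fst z)) (\<lambda>i. lin (fst z 0) (fst (fst z i))) t))" for s
    by measurable
  have If: "(\<lambda>z. if P z then f z else g z) \<in> measurable ?M (count_space UNIV)"
    if "Measurable.pred ?M P" "f \<in> measurable ?M (count_space UNIV)" "g \<in> measurable ?M (count_space UNIV)"
    for P and f g :: "(nat \<Rightarrow> lent) \<times> pt \<Rightarrow> int option"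
    using that by measurable
  have t0: "Measurable.pred ?M (\<lambda>z. t = 0)" by simp
  have const: "(\<lambda>z. c) \<in> measurable ?M (count_space UNIV)" for c :: "int option" by simp
  show ?thesis
    unfolding predict_def Let_def case_prod_beta le if_distrib[of Some]
    by (intro If t0 const drop pred_splits[OF C g] pred_exists_pos[OF C g] pred_intros_logic)
qed

lemma learner_measurable_return:
  assumes "\<And>t. (\<lambda>(v, x). f t v x) \<in> measurable (lhistM \<Otimes>\<^sub>M (borel :: pt measure)) (count_space UNIV)"
  shows "learner_measurable (\<lambda>t v x. return_pmf (f t v x))"
  unfolding learner_measurable_def
proof (intro allI)
  fix t p
  have "(\<lambda>y. indicator {p} y :: real) \<circ> (\<lambda>(v, x). f t v x) \<in> borel_measurable (lhistM \<Otimes>\<^sub>M borel)"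
    by (rule measurable_comp[OF assms]) simp
  then show "(\<lambda>(v, x). pmf (return_pmf (f t v x)) p) \<in> borel_measurable (lhistM \<Otimes>\<^sub>M borel)"
    by (simp add: comp_def case_prod_beta pmf_return indicator_def eq_commute)
qed

section \<open>Deviation between a sample and its ghost\<close>

definition deviates :: "nat \<Rightarrow> nat \<Rightarrow> nat \<Rightarrow> (nat \<Rightarrow> pt) \<Rightarrow> bool" where
  "deviates K N j x \<longleftrightarrow> (\<exists>B\<in>sign_regions K (2 * j) x. unbalanced N j B)"

lemma dichotomies_cong: "(\<And>i. i < n \<Longrightarrow> x i = y i) \<Longrightarrow> dichotomies n x = dichotomies n y"
  by (simp add: dichotomies_def cong: conj_cong)

lemma deviates_cong: "(\<And>i. i < 2 * j \<Longrightarrow> x i = y i) \<Longrightarrow> deviates K N j x = deviates K N j y"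
  using dichotomies_cong[of "2 * j" x y] by (simp add: deviates_def sign_regions_def)

text \<open>Strict signs make the set of separating pairs of normal and offset open, so
  \<open>pred_exists_open\<close> applies.\<close>

lemma pred_dichotomies:
  assumes "\<And>i. i < n \<Longrightarrow> (\<lambda>z. x z i) \<in> borel_measurable M"
  shows "Measurable.pred M (\<lambda>z. I \<in> dichotomies n (x z))"
proof -
  let ?P = "\<lambda>z p. \<forall>i\<in>{..<n}. 0 < (if i \<in> I then 1 else - 1) * (fst p \<bullet> x z i + snd p)"
  have "I \<in> dichotomies n (x z) \<longleftrightarrow> I \<subseteq> {..<n} \<and> (\<exists>p. ?P z p)" for z
  proof -
    have "0 < (if i \<in> I then 1 else - 1) * (w \<bullet> x z i + b) \<longleftrightarrow>
        (if i \<in> I then w \<bullet> x z i + b > 0 else w \<bullet> x z i + b < 0)" for i w b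
      by auto
    then show ?thesis by (simp only: dichotomies_def split_paired_Ex fst_conv snd_conv Ball_def lessThan_iff mem_Collect_eq)
  qed
  moreover have "Measurable.pred M (\<lambda>z. \<exists>p. ?P z p)"
  proof (rule pred_exists_open)
    show "open {p. ?P z p}" for z
    proof -
      have "{p. ?P z p} = (\<Inter>i\<in>{..<n}. {p. 0 < (if i \<in> I then 1 else - 1) * (fst p \<bullet> x z i + snd p)})" by blast
      moreover have op: "open {p. 0 < c * (fst p \<bullet> y + snd p)}" for c y
        by (intro open_Collect_less continuous_intros)
      ultimately show ?thesis by (simp only:) (intro open_INT ballI op finite_lessThan)
    qed
    note [measurable] = assms
    show "Measurable.pred M (\<lambda>z. ?P z p)" for p
      by (intro pred_intros_finite(3)) (auto intro!: borel_measurable_pred_less borel_measurable_times borel_measurable_add borel_measurable_inner assms)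
  qed
  ultimately show ?thesis by simp
qed

lemma pred_deviates:
  assumes "\<And>i. i < 2 * j \<Longrightarrow> (\<lambda>z. x z i) \<in> borel_measurable M"
  shows "Measurable.pred M (\<lambda>z. deviates K N j (x z))"
proof -
  let ?F = "{..<K} \<rightarrow>\<^sub>E Pow {..<2 * j}"
  have "deviates K N j (x z) \<longleftrightarrow> (\<exists>I\<in>?F. \<exists>J\<in>?F. (\<forall>k\<in>{..<K}. I k \<in> dichotomies (2 * j) (x z)) \<and>
      (\<forall>k\<in>{..<K}. J k \<in> dichotomies (2 * j) (x z)) \<and> unbalanced N j ((\<Union>k<K. I k) \<inter> (\<Union>k<K. J k)))" for z
  proof -
    have "dichotomies (2 * j) (x z) \<subseteq> Pow {..<2 * j}" by (auto simp: dichotomies_def)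
    then have "{..<K} \<rightarrow>\<^sub>E dichotomies (2 * j) (x z) = {I \<in> ?F. \<forall>k\<in>{..<K}. I k \<in> dichotomies (2 * j) (x z)}"
      by (fastforce simp: PiE_iff)
    then show ?thesis by (auto simp: deviates_def sign_regions_def)
  qed
  moreover have "finite ?F" by (intro finite_PiE) auto
  ultimately show ?thesis
    by (auto intro!: pred_intros_finite(3,4) pred_intros_logic pred_dichotomies assms)
qed

text \<open>A deviating swap makes the swap of some region of the unswapped sample unbalanced, so a
  union bound over at most \<open>(2 * j + 1) ^ (6 * K)\<close> regions suffices.\<close>

lemma sum_swaps_deviates:
  assumes "K > 0"
  shows "real (card {S. S \<subseteq> {..<j} \<and> deviates K N j (\<lambda>i. x (swap_halves j S i))})
    \<le> real ((2 * j + 1) ^ (6 * K)) * (2 ^ j * (81 / 128) ^ N)"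
proof -
  let ?R = "sign_regions K (2 * j) x"
  let ?U = "\<lambda>B. {S. S \<subseteq> {..<j} \<and> unbalanced N j (swap_halves j S ` B)}"
  have fin: "finite (?U B)" for B by (rule finite_subset[of _ "Pow {..<j}"]) auto
  have "{S. S \<subseteq> {..<j} \<and> deviates K N j (\<lambda>i. x (swap_halves j S i))} \<subseteq> (\<Union>B\<in>?R. ?U B)"
  proof
    fix S assume S: "S \<in> {S. S \<subseteq> {..<j} \<and> deviates K N j (\<lambda>i. x (swap_halves j S i))}"
    then obtain B where B: "B \<in> sign_regions K (2 * j) (\<lambda>i. x (swap_halves j S i))" "unbalanced N j B"
      by (auto simp: deviates_def)
    have "swap_halves j S ` swap_halves j S ` B = B" by (simp add: image_image)
    then have "S \<in> ?U (swap_halves j S ` B)" using S B(2) by simp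
    then show "S \<in> (\<Union>B\<in>?R. ?U B)" using sign_regions_swap[OF B(1)] by blast
  qed
  then have "card {S. S \<subseteq> {..<j} \<and> deviates K N j (\<lambda>i. x (swap_halves j S i))} \<le> card (\<Union>B\<in>?R. ?U B)"
    using fin by (intro card_mono) auto
  also have "\<dots> \<le> (\<Sum>B\<in>?R. card (?U B))" by (rule card_UN_le) simp
  finally have "real (card {S. S \<subseteq> {..<j} \<and> deviates K N j (\<lambda>i. x (swap_halves j S i))}) \<le> real (\<Sum>B\<in>?R. card (?U B))"
    by (simp only: of_nat_le_iff)
  also have "\<dots> = (\<Sum>B\<in>?R. real (card (?U B)))" by (rule of_nat_sum)
  also have "\<dots> \<le> (\<Sum>B\<in>?R. 2 ^ j * (81 / 128) ^ N)"
    using assms by (intro sum_mono unbalanced_swaps) (rule sign_regions_subset)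
  also have "\<dots> = real (card ?R) * (2 ^ j * (81 / 128) ^ N)" by simp
  also have "\<dots> \<le> real ((2 * j + 1) ^ (6 * K)) * (2 ^ j * (81 / 128) ^ N)"
    using card_sign_regions by (intro mult_right_mono) (auto simp del: of_nat_power)
  finally show ?thesis .
qed

text \<open>Symmetrisation: the law of \<open>2 * j\<close> independent points is invariant under
  every swap, so \<open>2 ^ j\<close> times the probability is the expected number of deviating
  swaps, which \<open>sum_swaps_deviates\<close> bounds for each fixed sample.\<close>

lemma deviation_probability:
  fixes D :: "pt measure"
  assumes D: "prob_space D" "sets D = sets borel" and "K > 0"
  shows "(\<integral>\<^sup>+ x. indicator {x. deviates K N j x} x \<partial>Pi\<^sub>M {..<2 * j} (\<lambda>_. D))
    \<le> ennreal (real ((2 * j + 1) ^ (6 * K)) * (81 / 128) ^ N)"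
proof -
  let ?P = "Pi\<^sub>M {..<2 * j} (\<lambda>_. D)"
  let ?s = "swap_halves j"
  let ?f = "\<lambda>x. indicator {x. deviates K N j x} x :: ennreal"
  let ?c = "real ((2 * j + 1) ^ (6 * K)) * (81 / 128) ^ N"
  interpret P: prob_space ?P using D(1) by (intro prob_space_PiM)
  have comp: "(\<lambda>x. x i) \<in> borel_measurable ?P" if "i < 2 * j" for i
    using measurable_component_singleton[of i "{..<2 * j}" "\<lambda>_. D"] that D(2) by (simp cong: measurable_cong_sets)
  have meas: "(\<lambda>x. indicator {x. deviates K N j x} (\<lambda>i. x (?s S i)) :: ennreal) \<in> borel_measurable ?P" for S
  proof -
    have "Measurable.pred ?P (\<lambda>x. deviates K N j (\<lambda>i. x (?s S i)))"
      using comp by (intro pred_deviates) simp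
    then show ?thesis by (simp add: indicator_def)
  qed
  have meas0: "?f \<in> borel_measurable ?P"
  proof -
    have "Measurable.pred ?P (\<lambda>x. deviates K N j x)" using comp by (intro pred_deviates) simp
    then show ?thesis by (simp add: indicator_def)
  qed
  have inv: "(\<integral>\<^sup>+ x. ?f x \<partial>?P) = (\<integral>\<^sup>+ x. ?f (\<lambda>i. x (?s S i)) \<partial>?P)" for S
  proof -
    have "?P = distr ?P ?P (\<lambda>\<omega>. \<lambda>n\<in>{..<2 * j}. \<omega> (?s S n))"
      using distr_PiM_reindex[of "{..<2 * j}" "\<lambda>_. D" "?s S" "{..<2 * j}"] D(1)
      by (simp add: inj_on_subset[OF inj_swap_halves])
    then have "(\<integral>\<^sup>+ x. ?f x \<partial>?P) = (\<integral>\<^sup>+ x. ?f x \<partial>distr ?P ?P (\<lambda>\<omega>. \<lambda>n\<in>{..<2 * j}. \<omega> (?s S n)))"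
      by simp
    also have "\<dots> = (\<integral>\<^sup>+ x. ?f (\<lambda>n\<in>{..<2 * j}. x (?s S n)) \<partial>?P)"
    proof (rule nn_integral_distr)
      show "?f \<in> borel_measurable (distr ?P ?P (\<lambda>\<omega>. \<lambda>n\<in>{..<2 * j}. \<omega> (?s S n)))" using meas0 by simp
      show "(\<lambda>\<omega>. \<lambda>n\<in>{..<2 * j}. \<omega> (?s S n)) \<in> measurable ?P ?P"
        by (intro measurable_restrict measurable_component_singleton) simp
    qed
    also have "\<dots> = (\<integral>\<^sup>+ x. ?f (\<lambda>i. x (?s S i)) \<partial>?P)"
    proof (rule nn_integral_cong)
      fix x
      have "deviates K N j (\<lambda>n\<in>{..<2 * j}. x (?s S n)) = deviates K N j (\<lambda>i. x (?s S i))"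
        by (rule deviates_cong) simp
      then show "?f (\<lambda>n\<in>{..<2 * j}. x (?s S n)) = ?f (\<lambda>i. x (?s S i))" by (simp add: indicator_def)
    qed
    finally show ?thesis .
  qed
  have "2 ^ j * (\<integral>\<^sup>+ x. ?f x \<partial>?P) = (\<Sum>S\<in>Pow {..<j}. \<integral>\<^sup>+ x. ?f x \<partial>?P)"
    by (simp add: card_Pow)
  also have "\<dots> = (\<Sum>S\<in>Pow {..<j}. \<integral>\<^sup>+ x. ?f (\<lambda>i. x (?s S i)) \<partial>?P)"
    using inv by simp
  also have "\<dots> = (\<integral>\<^sup>+ x. (\<Sum>S\<in>Pow {..<j}. ?f (\<lambda>i. x (?s S i))) \<partial>?P)"
    using meas by (intro nn_integral_sum[symmetric]) simp
  also have "\<dots> \<le> (\<integral>\<^sup>+ x. ennreal (2 ^ j * ?c) \<partial>?P)"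
  proof (rule nn_integral_mono)
    fix x
    have "(\<Sum>S\<in>Pow {..<j}. ?f (\<lambda>i. x (?s S i))) = (\<Sum>S\<in>Pow {..<j}. if deviates K N j (\<lambda>i. x (?s S i)) then 1 else 0)"
      by (intro sum.cong) (auto simp: indicator_def)
    also have "\<dots> = (\<Sum>S\<in>{S \<in> Pow {..<j}. deviates K N j (\<lambda>i. x (?s S i))}. 1)"
      by (rule sum.inter_filter[symmetric]) simp
    also have "{S \<in> Pow {..<j}. deviates K N j (\<lambda>i. x (?s S i))} = {S. S \<subseteq> {..<j} \<and> deviates K N j (\<lambda>i. x (?s S i))}"
      by auto
    also have "(\<Sum>S\<in>\<dots>. 1) = ennreal (real (card {S. S \<subseteq> {..<j} \<and> deviates K N j (\<lambda>i. x (?s S i))}))"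
      by (simp add: ennreal_of_nat_eq_real_of_nat)
    also have "\<dots> \<le> ennreal (2 ^ j * ?c)"
      using sum_swaps_deviates[OF assms(3), of j N x] by (intro ennreal_leI) (simp add: algebra_simps)
    finally show "(\<Sum>S\<in>Pow {..<j}. ?f (\<lambda>i. x (?s S i))) \<le> ennreal (2 ^ j * ?c)" .
  qed
  also have "\<dots> = ennreal (2 ^ j * ?c)" by (simp add: P.emeasure_space_1)
  also have "\<dots> = 2 ^ j * ennreal ?c" by (simp add: ennreal_mult ennreal_power[symmetric])
  finally show ?thesis by (subst (asm) ennreal_mult_le_mult_iff) (auto simp: power_eq_top_ennreal)
qed

section \<open>Abstentions\<close>

text \<open>The conditional probability that a double sample of \<open>2 * j\<close> points
  deviates, given that it starts with \<open>ys\<close>. With \<open>length ys = j\<close> exactly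
  the ghost half is fresh; shorter \<open>ys\<close> occur while clean points are still being
  revealed.\<close>

definition ghost :: "pt measure \<Rightarrow> nat \<Rightarrow> nat \<Rightarrow> nat \<Rightarrow> pt list \<Rightarrow> ennreal" where
  "ghost D K N j ys = (\<integral>\<^sup>+ \<omega>. indicator {x. deviates K N j x} (\<lambda>i. if i < length ys then ys ! i else \<omega> i)
     \<partial>Pi\<^sub>M {length ys..<2 * j} (\<lambda>_. D))"

lemma borel_measurable_component:
  assumes "sets D = sets (borel :: pt measure)" "i \<in> I"
  shows "(\<lambda>\<omega>. \<omega> i) \<in> borel_measurable (Pi\<^sub>M I (\<lambda>_. D))"
  using measurable_component_singleton[of i I "\<lambda>_. D"] assms by (simp cong: measurable_cong_sets)

lemma borel_measurable_ghost_integrand: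
  assumes "sets D = sets (borel :: pt measure)"
  shows "(\<lambda>\<omega>. indicator {x. deviates K N j x} (\<lambda>i. if i < J then c i else \<omega> i) :: ennreal)
    \<in> borel_measurable (Pi\<^sub>M {J..<2 * j} (\<lambda>_. D))"
proof -
  have "Measurable.pred (Pi\<^sub>M {J..<2 * j} (\<lambda>_. D)) (\<lambda>\<omega>. deviates K N j (\<lambda>i. if i < J then c i else \<omega> i))"
  proof (rule pred_deviates)
    fix i assume "i < 2 * j"
    then show "(\<lambda>\<omega>. if i < J then c i else \<omega> i) \<in> borel_measurable (Pi\<^sub>M {J..<2 * j} (\<lambda>_. D))"
      by (cases "i < J") (auto intro!: borel_measurable_component assms)
  qed
  then show ?thesis by (simp add: indicator_def)
qed

lemma ghost_Nil:
  assumes "prob_space D" "sets D = sets (borel :: pt measure)" "K > 0"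
  shows "ghost D K N j [] \<le> ennreal (real ((2 * j + 1) ^ (6 * K)) * (81 / 128) ^ N)"
  using deviation_probability[OF assms, of j N] by (simp add: ghost_def atLeast0LessThan)

lemma nth_append_singleton_if:
  "(if i < length (ys @ [x]) then (ys @ [x]) ! i else \<omega> i)
    = (if i < length ys then ys ! i else fun_upd \<omega> (length ys) x i)"
  by (auto simp: nth_append less_Suc_eq)

text \<open>Fubini for the coordinate \<open>length ys\<close>. This martingale property carries the
  deviation terms through the clean rounds without loss.\<close>

lemma ghost_append:
  assumes D: "prob_space D" "sets D = sets (borel :: pt measure)" and "length ys < 2 * j"
  shows "(\<lambda>x. ghost D K N j (ys @ [x])) \<in> borel_measurable D"
    and "(\<integral>\<^sup>+ x. ghost D K N j (ys @ [x]) \<partial>D) = ghost D K N j ys"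
proof -
  let ?J = "length ys"
  let ?f = "\<lambda>\<omega>. indicator {x. deviates K N j x} (\<lambda>i. if i < ?J then ys ! i else \<omega> i) :: ennreal"
  interpret D: prob_space D by fact
  interpret P: product_sigma_finite "\<lambda>_::nat. D" by standard
  interpret Q: prob_space "Pi\<^sub>M {Suc ?J..<2 * j} (\<lambda>_. D)" using D(1) by (intro prob_space_PiM)
  have I: "{?J..<2 * j} = insert ?J {Suc ?J..<2 * j}" using assms(3) by auto
  have g: "ghost D K N j (ys @ [x]) = (\<integral>\<^sup>+ \<omega>. ?f (fun_upd \<omega> ?J x) \<partial>Pi\<^sub>M {Suc ?J..<2 * j} (\<lambda>_. D))" for x
    unfolding ghost_def nth_append_singleton_if by simp
  have f: "?f \<in> borel_measurable (Pi\<^sub>M (insert ?J {Suc ?J..<2 * j}) (\<lambda>_. D))"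
    unfolding I[symmetric] by (rule borel_measurable_ghost_integrand[OF D(2)])
  have "(\<lambda>(x, \<omega>). fun_upd \<omega> ?J x) \<in> measurable (D \<Otimes>\<^sub>M Pi\<^sub>M {Suc ?J..<2 * j} (\<lambda>_. D)) (Pi\<^sub>M (insert ?J {Suc ?J..<2 * j}) (\<lambda>_. D))"
    by measurable
  from measurable_compose[OF this f]
  have "(\<lambda>(x, \<omega>). ?f (fun_upd \<omega> ?J x)) \<in> borel_measurable (D \<Otimes>\<^sub>M Pi\<^sub>M {Suc ?J..<2 * j} (\<lambda>_. D))"
    by (simp only: case_prod_unfold)
  then show "(\<lambda>x. ghost D K N j (ys @ [x])) \<in> borel_measurable D"
    unfolding g by (rule Q.borel_measurable_nn_integral)
  show "(\<integral>\<^sup>+ x. ghost D K N j (ys @ [x]) \<partial>D) = ghost D K N j ys"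
    unfolding g using P.product_nn_integral_insert_rev[OF _ _ f] by (simp add: ghost_def I)
qed

text \<open>Point and line trade places: the dual point \<open>e\<close> becomes a normal vector and
  the sample point the argument, so polygon vertices turn into hypotheses on the sample.\<close>

lemma sign_region_lin:
  assumes "finite E" "E \<noteq> {}" "card E \<le> K"
  shows "{i. i < n \<and> (\<exists>e\<in>E. lin e0 (x i) e > 0) \<and> (\<exists>e\<in>E. lin e0 (x i) e < 0)} \<in> sign_regions K n x"
proof -
  let ?h = "\<lambda>e. (e, real_of_int (fst (snd e0)) - e \<bullet> fst e0)"
  have "lin e0 u e = e \<bullet> u + (real_of_int (fst (snd e0)) - e \<bullet> fst e0)" for u e
    by (simp add: lin_def aff_def inner_diff_right)
  moreover have "{i. i < n \<and> (\<exists>(w, b)\<in>?h ` E. w \<bullet> x i + b > 0) \<and> (\<exists>(w, b)\<in>?h ` E. w \<bullet> x i + b < 0)} \<in> sign_regions K n x"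
    using assms card_image_le[of E ?h] by (intro sign_regionI) auto
  ultimately show ?thesis by simp
qed

text \<open>When many past lines cross the version space this is Markov's inequality over the rarely crossed ones.\<close>

lemma ghost_abstentions:
  assumes lab: "labelled w b t v" and t: "t > 0" and N: "N > 0"
    and K: "4 + 2 * card {i. i < t \<and> mistake (v i)} \<le> K"
    and past: "\<And>P. card {i. i < J \<and> P (z i)} \<le> card {i. i < t \<and> P (fst (v i))}"
    and dev: "\<not> deviates K N J z"
  shows "card {i \<in> {J..<2 * J}. predict N t v (z i) = None} \<le> 16 * N"
proof -
  define C where "C = version_space t v"
  define G where "G i = lin (v 0) (fst (v i))" for i
  define A where "A = {i \<in> {J..<2 * J}. predict N t v (z i) = None}"
  define n where "n = card {a. a < t \<and> splits C (G a)}"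
  have "finite A" by (simp add: A_def)
  \<comment> \<open>By \<open>past\<close>, few hits in all past rounds mean few hits in the first
    half of \<open>z\<close>; the absence of deviation then limits the hits in the second
    half.\<close>
  have few: "card {i \<in> {J..<2 * J}. P (z i)} < 4 * N"
    if "{i. i < 2 * J \<and> P (z i)} \<in> sign_regions K (2 * J) z" "card {i. i < t \<and> P (fst (v i))} < N" for P
  proof -
    have "{i. i < 2 * J \<and> P (z i)} \<inter> {..<J} = {i. i < J \<and> P (z i)}" by auto
    then have "card ({i. i < 2 * J \<and> P (z i)} \<inter> {..<J}) < N" using past[of P] that(2) by simp
    then have "card ({i. i < 2 * J \<and> P (z i)} \<inter> {J..<2 * J}) < 4 * N"
      using dev that(1) by (auto simp: deviates_def unbalanced_def not_le)
    also have "{i. i < 2 * J \<and> P (z i)} \<inter> {J..<2 * J} = {i \<in> {J..<2 * J}. P (z i)}" by auto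
    finally show ?thesis .
  qed
  have none: "splits C (lin (v 0) (z i))" "n < N \<or> n \<le> 4 * card {a. a < t \<and> splits C (G a) \<and>
      shatters C (lin (v 0) (z i)) (G a) \<and> card {u. u < t \<and> shatters C (G u) (G a)} < N}" if "i \<in> A" for i
    using predict_None[of N t v "z i"] that by (auto simp: A_def C_def G_def n_def)
  show ?thesis
  proof (cases "n < N")
    case True
    \<comment> \<open>Every abstention needs a line that splits \<open>C\<close>, and fewer than
      \<open>N\<close> past lines do so.\<close>
    obtain E where E: "finite E" "E \<noteq> {}" "card E \<le> K"
      "\<forall>u\<in>z ` {..<2 * J}. splits C (lin (v 0) u) \<longleftrightarrow> (\<exists>e\<in>E. lin (v 0) u e > 0) \<and> (\<exists>e\<in>E. lin (v 0) u e < 0)"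
      using version_space_splits_representation[OF lab t, of "z ` {..<2 * J}"] K unfolding C_def by force
    have "{i. i < 2 * J \<and> splits C (lin (v 0) (z i))} =
        {i. i < 2 * J \<and> (\<exists>e\<in>E. lin (v 0) (z i) e > 0) \<and> (\<exists>e\<in>E. lin (v 0) (z i) e < 0)}"
      using E(4) by auto
    then have "{i. i < 2 * J \<and> splits C (lin (v 0) (z i))} \<in> sign_regions K (2 * J) z"
      using sign_region_lin[OF E(1-3)] by simp
    then have "card {i \<in> {J..<2 * J}. splits C (lin (v 0) (z i))} < 4 * N"
      using few[of "\<lambda>u. splits C (lin (v 0) u)"] True by (simp add: n_def G_def)
    moreover have "card A \<le> card {i \<in> {J..<2 * J}. splits C (lin (v 0) (z i))}"
      using none(1) by (intro card_mono) (auto simp: A_def)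
    ultimately show ?thesis by (simp add: A_def)
  next
    case False
    define S where "S = {a. a < t \<and> splits C (G a) \<and> card {u. u < t \<and> shatters C (G u) (G a)} < N}"
    have "finite S" by (simp add: S_def)
    have "card S \<le> n" unfolding n_def by (intro card_mono) (auto simp: S_def)
    have cross: "card {i \<in> A. shatters C (lin (v 0) (z i)) (G a)} \<le> 4 * N" if a: "a \<in> S" for a
    proof -
      obtain E where E: "finite E" "E \<noteq> {}" "card E \<le> 2"
        "\<forall>u\<in>z ` {..<2 * J}. shatters C (lin (v 0) u) (G a) \<longleftrightarrow> (\<exists>e\<in>E. lin (v 0) u e > 0) \<and> (\<exists>e\<in>E. lin (v 0) u e < 0)"
        using version_space_shatters_representation[of "z ` {..<2 * J}" t v "fst (v a)"] a
        unfolding C_def G_def S_def by auto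
      have "{i. i < 2 * J \<and> shatters C (lin (v 0) (z i)) (G a)} =
          {i. i < 2 * J \<and> (\<exists>e\<in>E. lin (v 0) (z i) e > 0) \<and> (\<exists>e\<in>E. lin (v 0) (z i) e < 0)}"
        using E(4) by auto
      moreover have "card E \<le> K" using E(3) K by linarith
      ultimately have "{i. i < 2 * J \<and> shatters C (lin (v 0) (z i)) (G a)} \<in> sign_regions K (2 * J) z"
        using sign_region_lin[OF E(1,2)] by simp
      then have "card {i \<in> {J..<2 * J}. shatters C (lin (v 0) (z i)) (G a)} < 4 * N"
        using few[of "\<lambda>u. shatters C (lin (v 0) u) (G a)"] a by (simp add: S_def G_def)
      moreover have "card {i \<in> A. shatters C (lin (v 0) (z i)) (G a)} \<le> card {i \<in> {J..<2 * J}. shatters C (lin (v 0) (z i)) (G a)}"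
        by (intro card_mono) (auto simp: A_def)
      ultimately show ?thesis by linarith
    qed
    \<comment> \<open>Double counting of crossings between ghosts with abstention and lines in
      \<open>S\<close>: each such ghost crosses at least \<open>n / 4\<close> of the lines, each
      line is crossed by at most \<open>4 * N\<close> ghosts, and
      \<open>card S \<le> n\<close>.\<close>
    have "n * card A = (\<Sum>i\<in>A. n)" by simp
    also have "\<dots> \<le> (\<Sum>i\<in>A. 4 * card {a \<in> S. shatters C (lin (v 0) (z i)) (G a)})"
    proof (rule sum_mono)
      fix i assume "i \<in> A"
      moreover have "{a. a < t \<and> splits C (G a) \<and> shatters C (lin (v 0) (z i)) (G a) \<and> card {u. u < t \<and> shatters C (G u) (G a)} < N}
          = {a \<in> S. shatters C (lin (v 0) (z i)) (G a)}" by (auto simp: S_def)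
      ultimately show "n \<le> 4 * card {a \<in> S. shatters C (lin (v 0) (z i)) (G a)}"
        using none(2)[of i] False by simp
    qed
    also have "\<dots> = 4 * (\<Sum>i\<in>A. \<Sum>a\<in>S. if shatters C (lin (v 0) (z i)) (G a) then 1 else 0)"
      using \<open>finite S\<close> by (simp add: sum_distrib_left[symmetric] sum.inter_filter[symmetric])
    also have "\<dots> = 4 * (\<Sum>a\<in>S. \<Sum>i\<in>A. if shatters C (lin (v 0) (z i)) (G a) then 1 else 0)"
      by (subst sum.swap) simp
    also have "\<dots> = 4 * (\<Sum>a\<in>S. card {i \<in> A. shatters C (lin (v 0) (z i)) (G a)})"
      using \<open>finite A\<close> by (simp add: sum.inter_filter[symmetric])
    also have "\<dots> \<le> 4 * (\<Sum>a\<in>S. 4 * N)"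
      using cross by (intro mult_left_mono sum_mono) auto
    also have "\<dots> \<le> n * (16 * N)" using \<open>card S \<le> n\<close> by simp
    finally have "n * card A \<le> n * (16 * N)" .
    moreover have "n > 0" using False N by simp
    ultimately show ?thesis by (simp add: A_def)
  qed
qed

lemma measurable_predict_section:
  assumes "sets D = sets (borel :: pt measure)"
  shows "predict N t v \<in> measurable D (count_space UNIV)"
proof -
  have "v \<in> space lhistM" by (simp add: lhistM_def lentM_def space_PiM space_pair_measure)
  then have "(\<lambda>x. (v, x)) \<in> measurable D (lhistM \<Otimes>\<^sub>M (borel :: pt measure))"
    using assms by (simp cong: measurable_cong_sets)
  from measurable_compose[OF this measurable_predict[of N t]] show ?thesis by simp
qed

text \<open>The history \<open>v\<close> does not depend on the ghosts, so the expected number of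
  ghosts with abstention is \<open>length ys\<close> times the probability in question. That number
  is at most \<open>16 * N\<close> without a deviation and at most \<open>length ys\<close> with
  one.\<close>

lemma abstention_probability:
  assumes D: "prob_space D" "sets D = sets (borel :: pt measure)"
    and lab: "labelled w b t v" and t: "t > 0" and N: "N > 0"
    and K: "4 + 2 * card {i. i < t \<and> mistake (v i)} \<le> K"
    and past: "\<And>P. card {i. i < length ys \<and> P (ys ! i)} \<le> card {i. i < t \<and> P (fst (v i))}"
    and J: "length ys > 0"
  shows "(\<integral>\<^sup>+ x. (if predict N t v x = None then 1 else 0) \<partial>D)
    \<le> ennreal (16 * real N / real (length ys)) + ghost D K N (length ys) ys"
proof -
  let ?J = "length ys"
  let ?P = "Pi\<^sub>M {?J..<2 * ?J} (\<lambda>_. D)"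
  let ?f = "\<lambda>x. if predict N t v x = None then 1 else (0::ennreal)"
  let ?z = "\<lambda>\<omega> i. if i < ?J then ys ! i else \<omega> i"
  let ?d = "\<lambda>\<omega>. indicator {x. deviates K N ?J x} (?z \<omega>) :: ennreal"
  interpret P: prob_space ?P using D(1) by (intro prob_space_PiM)
  have f: "?f \<in> borel_measurable D"
    using measurable_predict_section[OF D(2), of N t v] by measurable
  have comp: "(\<integral>\<^sup>+ \<omega>. ?f (\<omega> i) \<partial>?P) = (\<integral>\<^sup>+ x. ?f x \<partial>D)" if "i \<in> {?J..<2 * ?J}" for i
  proof -
    have "(\<integral>\<^sup>+ x. ?f x \<partial>distr ?P D (\<lambda>\<omega>. \<omega> i)) = (\<integral>\<^sup>+ \<omega>. ?f (\<omega> i) \<partial>?P)"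
      using that f by (intro nn_integral_distr measurable_component_singleton) auto
    moreover have "distr ?P D (\<lambda>\<omega>. \<omega> i) = D"
      using that D(1) by (intro distr_PiM_component) auto
    ultimately show ?thesis by simp
  qed
  have fi: "(\<lambda>\<omega>. ?f (\<omega> i)) \<in> borel_measurable ?P" if "i \<in> {?J..<2 * ?J}" for i
    using measurable_compose[OF measurable_component_singleton[OF that, of "\<lambda>_. D"] f] by simp
  have d: "?d \<in> borel_measurable ?P" by (rule borel_measurable_ghost_integrand[OF D(2)])
  have "of_nat ?J * (\<integral>\<^sup>+ x. ?f x \<partial>D) = (\<Sum>i\<in>{?J..<2 * ?J}. \<integral>\<^sup>+ \<omega>. ?f (\<omega> i) \<partial>?P)"
    by (simp add: comp)
  also have "\<dots> = (\<integral>\<^sup>+ \<omega>. (\<Sum>i\<in>{?J..<2 * ?J}. ?f (\<omega> i)) \<partial>?P)"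
    using fi by (intro nn_integral_sum[symmetric])
  also have "\<dots> \<le> (\<integral>\<^sup>+ \<omega>. of_nat (16 * N) + of_nat ?J * ?d \<omega> \<partial>?P)"
  proof (rule nn_integral_mono)
    fix \<omega>
    have "(\<Sum>i\<in>{?J..<2 * ?J}. ?f (\<omega> i)) = of_nat (card {i \<in> {?J..<2 * ?J}. predict N t v (?z \<omega> i) = None})"
    proof -
      have "(\<Sum>i\<in>{?J..<2 * ?J}. ?f (\<omega> i)) = (\<Sum>i\<in>{i \<in> {?J..<2 * ?J}. predict N t v (\<omega> i) = None}. 1)"
        by (rule sum.inter_filter[symmetric]) simp
      also have "{i \<in> {?J..<2 * ?J}. predict N t v (\<omega> i) = None} = {i \<in> {?J..<2 * ?J}. predict N t v (?z \<omega> i) = None}"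
        by auto
      finally show ?thesis by simp
    qed
    also have "\<dots> \<le> of_nat (16 * N) + of_nat ?J * ?d \<omega>"
    proof (cases "deviates K N ?J (?z \<omega>)")
      case True
      have "card {i \<in> {?J..<2 * ?J}. predict N t v (?z \<omega> i) = None} \<le> card {?J..<2 * ?J}"
        by (intro card_mono) auto
      then have "of_nat (card {i \<in> {?J..<2 * ?J}. predict N t v (?z \<omega> i) = None}) \<le> (of_nat ?J :: ennreal)"
        by (simp only: of_nat_le_iff) simp
      also have "\<dots> \<le> of_nat (16 * N) + of_nat ?J * ?d \<omega>" using True by simp
      finally show ?thesis .
    next
      case False
      have "card {i. i < ?J \<and> P (?z \<omega> i)} \<le> card {i. i < t \<and> P (fst (v i))}" for P
      proof -
        have "{i. i < ?J \<and> P (?z \<omega> i)} = {i. i < ?J \<and> P (ys ! i)}" by auto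
        then show ?thesis using past[of P] by simp
      qed
      from ghost_abstentions[OF lab t N K this False]
      have "of_nat (card {i \<in> {?J..<2 * ?J}. predict N t v (?z \<omega> i) = None}) \<le> (of_nat (16 * N) :: ennreal)"
        by (simp only: of_nat_le_iff)
      then show ?thesis using False by simp
    qed
    finally show "(\<Sum>i\<in>{?J..<2 * ?J}. ?f (\<omega> i)) \<le> of_nat (16 * N) + of_nat ?J * ?d \<omega>" .
  qed
  also have "\<dots> = of_nat (16 * N) + of_nat ?J * ghost D K N ?J ys"
    using d by (simp add: nn_integral_add nn_integral_cmult P.emeasure_space_1 ghost_def)
  also have "\<dots> = of_nat ?J * (ennreal (16 * real N / real ?J) + ghost D K N ?J ys)"
  proof -
    have "of_nat ?J * ennreal (16 * real N / real ?J) = ennreal (real ?J) * ennreal (16 * real N / real ?J)"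
      by (simp add: ennreal_of_nat_eq_real_of_nat)
    also have "\<dots> = ennreal (real (16 * N))"
      using J by (subst ennreal_mult[symmetric]) auto
    also have "\<dots> = of_nat (16 * N)" by (simp only: ennreal_of_nat_eq_real_of_nat)
    finally show ?thesis by (simp add: distrib_left)
  qed
  finally show ?thesis using J by (subst (asm) ennreal_mult_le_mult_iff) auto
qed

section \<open>Recursion over the rounds of the game\<close>

definition clean :: "nat \<Rightarrow> (nat \<Rightarrow> ent) \<Rightarrow> pt list" where
  "clean t h = map (\<lambda>i. fst (h i)) (filter (\<lambda>i. \<not> fst (snd (h i))) [0..<t])"

lemma clean_upd:
  "clean (Suc t) (h(t := (x, q, y, p))) = clean t h @ (if q then [] else [x])"
  by (auto simp: clean_def intro!: map_cong filter_cong)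

text \<open>Supplies the hypothesis \<open>past\<close> of \<open>abstention_probability\<close>:
  injected rounds only add hits.\<close>

lemma card_clean:
  "card {i. i < length (clean t h) \<and> P (clean t h ! i)} \<le> card {i. i < t \<and> P (fst (view h i))}"
proof -
  have "card {i. i < length (clean t h) \<and> P (clean t h ! i)} = length (filter P (clean t h))"
    by (simp add: length_filter_conv_card)
  also have "\<dots> = length (filter (\<lambda>i. P (fst (h i)) \<and> \<not> fst (snd (h i))) [0..<t])"
    by (simp add: clean_def filter_map comp_def conj_commute)
  also have "\<dots> = card {i. i < t \<and> P (fst (h i)) \<and> \<not> fst (snd (h i))}"
    by (simp add: length_filter_conv_card cong: conj_cong)
  also have "\<dots> \<le> card {i. i < t \<and> P (fst (view h i))}"
    by (intro card_mono) (auto simp: view_def)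
  finally show ?thesis .
qed

text \<open>A history is a total function whose later entries get overwritten as the game proceeds;
  earlier predictions must not change with them.\<close>

lemma predict_cong:
  assumes "\<And>i. i < t \<Longrightarrow> v i = v' i"
  shows "predict N t v x = predict N t v' x"
proof (cases "t = 0")
  case False
  then have v0: "v 0 = v' 0" using assms by simp
  have C: "version_space t v = version_space t v'" using assms v0 by (auto simp: version_space_def)
  have "potential N C (\<lambda>i. lin (v 0) (fst (v i))) t = potential N C (\<lambda>i. lin (v' 0) (fst (v' i))) t" for C
  proof -
    have "{u. u < t \<and> shatters C (lin (v 0) (fst (v u))) (lin (v 0) (fst (v a)))} =
        {u. u < t \<and> shatters C (lin (v' 0) (fst (v' u))) (lin (v' 0) (fst (v' a)))}" if "a < t" for a
      using assms v0 that by auto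
    then show ?thesis unfolding potential_def weight_def
      using assms v0 by (intro sum.cong) auto
  qed
  then show ?thesis using C v0 by (simp add: predict_def Let_def)
qed (simp add: predict_def)

lemma labelled_upd:
  assumes "labelled w b t (view h)"
  shows "labelled w b (Suc t) (view (h(t := (x, q, halfspace w b x, p))))"
  using assms by (auto simp: labelled_def view_def less_Suc_eq)

lemma followed_upd:
  assumes "followed N t (view h)"
  shows "followed N (Suc t) (view (h(t := (x, q, y, predict N t (view h) x))))"
proof -
  let ?h = "h(t := (x, q, y, predict N t (view h) x))"
  have "predict N i (view ?h) u = predict N i (view h) u" if "i \<le> t" for i u
    using that by (intro predict_cong) (auto simp: view_def)
  then show ?thesis using assms by (auto simp: followed_def less_Suc_eq view_def[of ?h]) (simp_all add: view_def followed_def)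
qed

lemma mistakes_upd:
  "card {i. i < Suc t \<and> mistake (view (h(t := (x, q, y, p))) i)} =
    card {i. i < t \<and> mistake (view h i)} + (if p \<noteq> None \<and> p \<noteq> Some y then 1 else 0)"
proof -
  let ?h = "h(t := (x, q, y, p))"
  have "{i. i < Suc t \<and> mistake (view ?h i)} = {i. i < t \<and> mistake (view h i)} \<union>
      (if p \<noteq> None \<and> p \<noteq> Some y then {t} else {})"
    by (auto simp: view_def mistake_def less_Suc_eq)
  then show ?thesis by auto
qed

definition step_bound :: "nat \<Rightarrow> nat \<Rightarrow> ennreal" where
  "step_bound N j = (if j = 0 then 1 else ennreal (16 * real N / real j))"

text \<open>Mistakes already made are added to \<open>V\<close>, so that all mistakes together are
  capped by \<open>Mx\<close> once no round is left. Abstentions are charged to the number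
  \<open>j\<close> of clean points so far. Each clean round increases \<open>j\<close>, so every
  \<open>j\<close> is charged at most once, whatever the adversary does.\<close>

lemma V_bound:
  fixes A :: adv
  assumes D: "prob_space D" "sets D = sets (borel :: pt measure)" and N: "N > 0"
    and K: "4 + 2 * Mx \<le> K"
    and Mx: "\<And>t v. labelled w b t v \<Longrightarrow> followed N t v \<Longrightarrow> t \<le> T \<Longrightarrow> card {i. i < t \<and> mistake (v i)} \<le> Mx"
    and "t + n = T" "labelled w b t (view h)" "followed N t (view h)"
  shows "V (\<lambda>t v x. return_pmf (predict N t v x)) A D (halfspace w b) n t h
      + of_nat (card {i. i < t \<and> mistake (view h i)})
    \<le> of_nat Mx + (\<Sum>j\<in>{length (clean t h)..<length (clean t h) + n}. step_bound N j + ghost D K N j (clean t h))"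
  using assms(6-8)
proof (induction n arbitrary: t h)
  case 0
  then have "card {i. i < t \<and> mistake (view h i)} \<le> Mx" by (intro Mx) auto
  then show ?case by simp
next
  case (Suc n)
  let ?L = "\<lambda>t v x. return_pmf (predict N t v x)" and ?c = "halfspace w b"
  let ?p = "predict N t (view h)"
  let ?h = "\<lambda>q x. h(t := (x, q, ?c x, ?p x))"
  let ?m = "card {i. i < t \<and> mistake (view h i)}"
  let ?ys = "clean t h"
  let ?J = "length ?ys"
  let ?abs = "\<lambda>x. if ?p x = None then 1 else (0::ennreal)"
  interpret D: prob_space D by fact
  have IH: "V ?L A D ?c n (Suc t) (?h q x) + of_nat (card {i. i < Suc t \<and> mistake (view (?h q x) i)})
    \<le> of_nat Mx + (\<Sum>j\<in>{length (clean (Suc t) (?h q x))..<length (clean (Suc t) (?h q x)) + n}.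
        step_bound N j + ghost D K N j (clean (Suc t) (?h q x)))" for q x
    using Suc.prems by (intro Suc.IH labelled_upd followed_upd) auto
  have step: "loss (?p x) (?c x) q + V ?L A D ?c n (Suc t) (?h q x) + of_nat ?m
      \<le> (if q then 0 else ?abs x) + (of_nat Mx + (\<Sum>j\<in>{length (clean (Suc t) (?h q x))..<length (clean (Suc t) (?h q x)) + n}.
        step_bound N j + ghost D K N j (clean (Suc t) (?h q x))))" for q x
  proof -
    have "loss (?p x) (?c x) q + V ?L A D ?c n (Suc t) (?h q x) + of_nat ?m =
        (if q then 0 else ?abs x) + (V ?L A D ?c n (Suc t) (?h q x) + of_nat (card {i. i < Suc t \<and> mistake (view (?h q x) i)}))"
      unfolding mistakes_upd by (simp add: loss_def algebra_simps)
    also have "\<dots> \<le> (if q then 0 else ?abs x) + (of_nat Mx + (\<Sum>j\<in>{length (clean (Suc t) (?h q x))..<length (clean (Suc t) (?h q x)) + n}.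
        step_bound N j + ghost D K N j (clean (Suc t) (?h q x))))"
      by (rule add_left_mono[OF IH])
    finally show ?thesis .
  qed
  obtain q z where qz: "A t h = (q, z)" by fastforce
  show ?case
  proof (cases q)
    case True
    have "V ?L A D ?c (Suc n) t h + of_nat ?m = loss (?p z) (?c z) True + V ?L A D ?c n (Suc t) (?h True z) + of_nat ?m"
      using qz True by (simp add: nn_integral_return_pmf)
    also have "\<dots> \<le> of_nat Mx + (\<Sum>j\<in>{?J..<?J + n}. step_bound N j + ghost D K N j ?ys)"
      using step[of z True] by (simp add: clean_upd)
    \<comment> \<open>An injected round consumes a round but no clean index, so the sum just gains a
      nonnegative term.\<close>
    also have "\<dots> \<le> of_nat Mx + (\<Sum>j\<in>{?J..<?J + Suc n}. step_bound N j + ghost D K N j ?ys)"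
      by (intro add_left_mono sum_mono2) auto
    finally show ?thesis .
  next
    case False
    let ?g = "\<lambda>x. \<Sum>j\<in>{Suc ?J..<Suc ?J + n}. step_bound N j + ghost D K N j (?ys @ [x])"
    have gm: "(\<lambda>x. ghost D K N j (?ys @ [x])) \<in> borel_measurable D" if "j \<in> {Suc ?J..<Suc ?J + n}" for j
      using that by (intro ghost_append(1)[OF D]) auto
    have am: "?abs \<in> borel_measurable D"
      using measurable_predict_section[OF D(2), of N t "view h"] by measurable
    have gm': "?g \<in> borel_measurable D"
      using gm by (intro borel_measurable_sum borel_measurable_add) auto
    \<comment> \<open>Without any clean point, in particular in round 0, the trivial bound 1 is
      charged.\<close>
    have abs: "(\<integral>\<^sup>+ x. ?abs x \<partial>D) \<le> step_bound N ?J + ghost D K N ?J ?ys"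
    proof (cases "t = 0 \<or> ?J = 0")
      case True
      have "(\<integral>\<^sup>+ x. ?abs x \<partial>D) \<le> (\<integral>\<^sup>+ x. 1 \<partial>D)" by (intro nn_integral_mono) auto
      also have "\<dots> = 1" by (simp add: D.emeasure_space_1)
      also have "\<dots> \<le> step_bound N ?J + ghost D K N ?J ?ys"
        using True by (auto simp: step_bound_def clean_def)
      finally show ?thesis .
    next
      case False
      have "card {i. i < t \<and> mistake (view h i)} \<le> Mx" using Suc.prems by (intro Mx) auto
      then show ?thesis
        using abstention_probability[OF D Suc.prems(2) _ N _ card_clean, of K] False K by (simp add: step_bound_def)
    qed
    have "V ?L A D ?c (Suc n) t h + of_nat ?m =
        (\<integral>\<^sup>+ x. (loss (?p x) (?c x) False + V ?L A D ?c n (Suc t) (?h False x)) \<partial>D) + of_nat ?m"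
      using qz False by (simp add: nn_integral_return_pmf)
    also have "\<dots> \<le> (\<integral>\<^sup>+ x. ?abs x + (of_nat Mx + ?g x) \<partial>D)"
    proof -
      \<comment> \<open>Measurability of \<open>V\<close> is not established, so additivity of the
        integral cannot be applied to it. Instead the constant is subtracted from the measurable
        bound \<open>?r\<close> and added back after the comparison.\<close>
      let ?r = "\<lambda>x. ?abs x + (of_nat Mx + ?g x)"
      have le: "loss (?p x) (?c x) False + V ?L A D ?c n (Suc t) (?h False x) + of_nat ?m \<le> ?r x" for x
        using step[of x False] by (simp add: clean_upd)
      have m: "of_nat ?m \<le> ?r x" for x
        using le[of x] by (rule order.trans[rotated]) simp
      have "(\<integral>\<^sup>+ x. (loss (?p x) (?c x) False + V ?L A D ?c n (Suc t) (?h False x)) \<partial>D) \<le> (\<integral>\<^sup>+ x. ?r x - of_nat ?m \<partial>D)"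
        using le by (intro nn_integral_mono) (simp add: ennreal_le_minus_iff add.commute)
      then have "(\<integral>\<^sup>+ x. (loss (?p x) (?c x) False + V ?L A D ?c n (Suc t) (?h False x)) \<partial>D) + of_nat ?m
          \<le> (\<integral>\<^sup>+ x. ?r x - of_nat ?m \<partial>D) + (\<integral>\<^sup>+ x. of_nat ?m \<partial>D)"
        by (intro add_mono) (auto simp: D.emeasure_space_1)
      also have "\<dots> = (\<integral>\<^sup>+ x. (?r x - of_nat ?m) + of_nat ?m \<partial>D)"
        using am gm' by (intro nn_integral_add[symmetric]) auto
      also have "\<dots> = (\<integral>\<^sup>+ x. ?r x \<partial>D)"
        using m by (intro nn_integral_cong) (simp add: diff_add_cancel_ennreal)
      finally show ?thesis .
    qed
    also have "\<dots> = (\<integral>\<^sup>+ x. ?abs x \<partial>D) + (of_nat Mx + (\<integral>\<^sup>+ x. ?g x \<partial>D))"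
      using am gm' by (simp add: nn_integral_add D.emeasure_space_1)
    also have "(\<integral>\<^sup>+ x. ?g x \<partial>D) = (\<Sum>j\<in>{Suc ?J..<Suc ?J + n}. step_bound N j + ghost D K N j ?ys)"
    proof -
      have "(\<integral>\<^sup>+ x. ?g x \<partial>D) = (\<Sum>j\<in>{Suc ?J..<Suc ?J + n}. \<integral>\<^sup>+ x. step_bound N j + ghost D K N j (?ys @ [x]) \<partial>D)"
        using gm by (intro nn_integral_sum borel_measurable_add) auto
      also have "\<dots> = (\<Sum>j\<in>{Suc ?J..<Suc ?J + n}. step_bound N j + ghost D K N j ?ys)"
      proof (rule sum.cong)
        fix j assume j: "j \<in> {Suc ?J..<Suc ?J + n}"
        then have "?J < 2 * j" by auto
        then show "(\<integral>\<^sup>+ x. step_bound N j + ghost D K N j (?ys @ [x]) \<partial>D) = step_bound N j + ghost D K N j ?ys"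
          using gm[OF j] ghost_append(2)[OF D, of ?ys j K N] by (simp add: nn_integral_add D.emeasure_space_1)
      qed simp
      finally show ?thesis .
    qed
    also have "(\<integral>\<^sup>+ x. ?abs x \<partial>D) + (of_nat Mx + (\<Sum>j\<in>{Suc ?J..<Suc ?J + n}. step_bound N j + ghost D K N j ?ys))
        \<le> (step_bound N ?J + ghost D K N ?J ?ys) + (of_nat Mx + (\<Sum>j\<in>{Suc ?J..<Suc ?J + n}. step_bound N j + ghost D K N j ?ys))"
      by (rule add_right_mono[OF abs])
    also have "\<dots> = of_nat Mx + (\<Sum>j\<in>{?J..<?J + Suc n}. step_bound N j + ghost D K N j ?ys)"
      by (simp add: sum.atLeast_Suc_lessThan algebra_simps)
    finally show ?thesis .
  qed
qed

section \<open>Choice of the parameters\<close>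

lemma harmonic_sum_le: "n \<ge> 1 \<Longrightarrow> (\<Sum>j\<in>{1..n}. 1 / real j) \<le> 1 + ln (real n)"
proof (induction n rule: nat_induct_at_least)
  case (Suc n)
  have "ln (real n / real (Suc n)) \<le> real n / real (Suc n) - 1"
    using Suc.hyps by (intro ln_le_minus_one) auto
  also have "real n / real (Suc n) - 1 = - (1 / real (Suc n))" by (simp add: field_simps)
  finally have "1 / real (Suc n) \<le> ln (real (Suc n)) - ln (real n)"
    using Suc.hyps by (simp add: ln_div del: of_nat_Suc)
  then show ?case using Suc.IH by (simp del: of_nat_Suc)
qed simp

text \<open>Here \<open>r\<close> is the power 2/3 of \<open>T\<close>. In
  \<open>mistakes_bound\<close> the terms \<open>N\<^sup>2\<close>, \<open>T * N\<close> and
  \<open>T\<^sup>2\<close> are each at most \<open>r * N\<^sup>2\<close>, and 13 = 1 + 4 +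
  8.\<close>

lemma mistakes_le:
  assumes "labelled w b t v" "followed N t v" "t \<le> T"
    and N: "N > 0" "r \<le> real N" and r: "r \<ge> 1" "r ^ 3 = (real T)\<^sup>2" "real T \<le> r\<^sup>2"
  shows "real (card {i. i < t \<and> mistake (v i)}) \<le> 13 * r"
proof (cases "t = 0")
  case False
  let ?M = "card {i. i < t \<and> mistake (v i)}"
  have "N\<^sup>2 * ?M \<le> N\<^sup>2 + 4 * t * (N + 2 * T)"
    using mistakes_bound[OF assms(1,2) _ assms(3)] False by simp
  also have "\<dots> \<le> N\<^sup>2 + 4 * T * (N + 2 * T)" using assms(3) by simp
  finally have "real (N\<^sup>2 * ?M) \<le> real (N\<^sup>2 + 4 * T * (N + 2 * T))" by (simp only: of_nat_le_iff)
  then have total: "(real N)\<^sup>2 * real ?M \<le> (real N)\<^sup>2 + 4 * (real T * real N) + 8 * (real T)\<^sup>2"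
    by (simp add: algebra_simps power2_eq_square)
  have TN: "real T * real N \<le> r * (real N)\<^sup>2"
  proof -
    have "real T \<le> r * real N" using r N by (intro order.trans[OF r(3)]) (simp add: power2_eq_square)
    then have "real T * real N \<le> r * real N * real N" by (intro mult_right_mono) auto
    then show ?thesis by (simp add: power2_eq_square)
  qed
  have TT: "(real T)\<^sup>2 \<le> r * (real N)\<^sup>2"
  proof -
    have "r * r\<^sup>2 \<le> r * (real N)\<^sup>2" using r N by (intro mult_left_mono power_mono) auto
    then show ?thesis using r(2) by (simp add: power2_eq_square power3_eq_cube)
  qed
  have "(real N)\<^sup>2 \<le> r * (real N)\<^sup>2"
    using mult_right_mono[OF r(1), of "(real N)\<^sup>2"] by simp
  then have "(real N)\<^sup>2 * real ?M \<le> 13 * (r * (real N)\<^sup>2)" using total TN TT by linarith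
  then have "(real N)\<^sup>2 * real ?M \<le> (real N)\<^sup>2 * (13 * r)" by (simp add: mult_ac)
  then show ?thesis using N(1) by (simp add: mult_le_cancel_left)
qed (use r in simp)

lemma sum_step_bound:
  assumes "T \<ge> 1"
  shows "(\<Sum>j\<in>{0..<T}. step_bound N j) \<le> ennreal (1 + 16 * real N * (1 + ln (real T)))"
proof -
  have "(\<Sum>j\<in>{0..<T}. step_bound N j) = step_bound N 0 + (\<Sum>j\<in>{1..<T}. step_bound N j)"
    using assms by (simp add: sum.atLeast_Suc_lessThan)
  also have "(\<Sum>j\<in>{1..<T}. step_bound N j) = (\<Sum>j\<in>{1..<T}. ennreal (16 * real N / real j))"
    by (intro sum.cong) (auto simp: step_bound_def)
  also have "\<dots> = ennreal (\<Sum>j\<in>{1..<T}. 16 * real N / real j)"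
    by (intro sum_ennreal) auto
  also have "(\<Sum>j\<in>{1..<T}. 16 * real N / real j) \<le> (\<Sum>j\<in>{1..T}. 16 * real N / real j)"
    by (intro sum_mono2) auto
  also have "\<dots> = 16 * real N * (\<Sum>j\<in>{1..T}. 1 / real j)" by (simp add: sum_distrib_left)
  also have "\<dots> \<le> 16 * real N * (1 + ln (real T))"
    using harmonic_sum_le[OF assms] by (intro mult_left_mono) auto
  finally show ?thesis
    using assms by (simp add: step_bound_def ennreal_leI add_left_mono flip: ennreal_1 ennreal_plus)
qed

text \<open>The exponents balance: the three factors are at most \<open>exp (20 * r * L)\<close>,
  \<open>exp (180 * r * L)\<close> with 180 = 6 * 30, and
  \<open>exp (- N / 4) \<le> exp (- 200 * r * L)\<close>, which is where the constant 800 comes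
  from.\<close>

lemma deviation_bound_small:
  assumes "T \<ge> 1" and L: "L = 1 + ln (real T)" and r: "r \<ge> 1"
    and K: "real K \<le> 30 * r" and N: "800 * r * L \<le> real N"
  shows "real T * ((2 * real T) ^ (6 * K) * (81 / 128) ^ N) \<le> 1"
proof -
  have L1: "L \<ge> 1" using assms(1) by (simp add: L)
  have T: "real T > 0" using assms(1) by simp
  have "ln (2 * real T) \<le> L"
    using T ln_le_minus_one[of "2::real"] by (simp add: L ln_mult)
  moreover have "ln (2 * real T) \<ge> 0" using assms(1) by simp
  ultimately have "real (6 * K) * ln (2 * real T) \<le> (180 * r) * L"
    using K r by (intro mult_mono) auto
  moreover have "(2 * real T) ^ (6 * K) = exp (real (6 * K) * ln (2 * real T))"
    using T by (subst exp_of_nat_mult) simp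
  ultimately have 1: "(2 * real T) ^ (6 * K) \<le> exp (180 * r * L)" by simp
  have "(81 / 128 :: real) ^ N \<le> exp (- 1 / 4) ^ N"
    using exp_ge_add_one_self[of "- 1 / 4 :: real"] by (intro power_mono) auto
  also have "\<dots> = exp (- real N / 4)" by (simp flip: exp_of_nat_mult)
  also have "\<dots> \<le> exp (- 200 * r * L)" using N by simp
  finally have 2: "(81 / 128 :: real) ^ N \<le> exp (- 200 * r * L)" .
  have "real T = exp (ln (real T))" using T by simp
  also have "\<dots> \<le> exp (20 * r * L)"
  proof -
    have "1 * L \<le> (20 * r) * L" using r L1 by (intro mult_right_mono) auto
    then show ?thesis by (simp add: L)
  qed
  finally have 3: "real T \<le> exp (20 * r * L)" .
  have "real T * ((2 * real T) ^ (6 * K) * (81 / 128) ^ N) \<le> exp (20 * r * L) * (exp (180 * r * L) * exp (- 200 * r * L))"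
    by (intro mult_mono 1 2 3) auto
  also have "\<dots> = 1" by (simp flip: exp_add)
  finally show ?thesis .
qed

lemma sum_ghost_Nil:
  assumes D: "prob_space D" "sets D = sets (borel :: pt measure)" and "K > 0" "T \<ge> 1"
    and small: "real T * ((2 * real T) ^ (6 * K) * (81 / 128) ^ N) \<le> 1"
  shows "(\<Sum>j\<in>{0..<T}. ghost D K N j []) \<le> 1"
proof -
  have "(\<Sum>j\<in>{0..<T}. ghost D K N j []) \<le> (\<Sum>j\<in>{0..<T}. ennreal ((2 * real T) ^ (6 * K) * (81 / 128) ^ N))"
  proof (rule sum_mono)
    fix j assume "j \<in> {0..<T}"
    then have "2 * j + 1 \<le> 2 * T" by simp
    then have "real (2 * j + 1) \<le> 2 * real T" by linarith
    then have "real ((2 * j + 1) ^ (6 * K)) \<le> (2 * real T) ^ (6 * K)"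
      unfolding of_nat_power by (intro power_mono) auto
    then have "ennreal (real ((2 * j + 1) ^ (6 * K)) * (81 / 128) ^ N) \<le> ennreal ((2 * real T) ^ (6 * K) * (81 / 128) ^ N)"
      by (intro ennreal_leI mult_right_mono) auto
    then show "ghost D K N j [] \<le> ennreal ((2 * real T) ^ (6 * K) * (81 / 128) ^ N)"
      using ghost_Nil[OF D assms(3)] order.trans by blast
  qed
  also have "\<dots> = ennreal (real T * ((2 * real T) ^ (6 * K) * (81 / 128) ^ N))"
    by (simp add: ennreal_mult ennreal_of_nat_eq_real_of_nat)
  also have "\<dots> \<le> ennreal 1" using small by (rule ennreal_leI)
  finally show ?thesis by simp
qed

theorem theorem5p3:
  shows "\<exists>C::real. \<exists>k::nat. \<forall>T::nat. T \<ge> 1 \<longrightarrow>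
    (\<exists>L::learner. learner_measurable L \<and>
      (\<forall>(R::real measure) (A::real \<Rightarrow> adv) (D::pt measure) (w::pt) (b::real).
         prob_space R \<longrightarrow> sets R = sets borel \<longrightarrow> adversary_measurable R A \<longrightarrow>
         prob_space D \<longrightarrow> sets D = sets borel \<longrightarrow>
         exp_err L A R D (halfspace w b) T \<le> ennreal (C * real T powr (2/3) * (1 + ln (real T)) ^ k)))"
\<comment> \<open>One logarithm comes from \<open>N\<close>, the other from the harmonic sum. The
  constant covers 13 + 16 * 801 + 2 = 12831.\<close>
proof (rule exI[of _ 13000], rule exI[of _ 2], intro allI impI)
  fix T :: nat assume T: "T \<ge> 1"
  define r where "r = real T powr (2/3)"
  define l where "l = 1 + ln (real T)"
  define N where "N = nat \<lceil>800 * r * l\<rceil>"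
  \<comment> \<open>\<open>K\<close> must hold the \<open>4 + 2 * Mx\<close> vertices of the version
    space polygon; 4 + 26 \<open>r\<close> is at most 30 \<open>r\<close> because
    \<open>r \<ge> 1\<close>.\<close>
  define K where "K = nat \<lfloor>30 * r\<rfloor>"
  define Mx where "Mx = nat \<lfloor>13 * r\<rfloor>"
  have r1: "r \<ge> 1" using T by (simp add: r_def ge_one_powr_ge_zero)
  have l1: "l \<ge> 1" using T by (simp add: l_def)
  have r3: "r ^ 3 = (real T)\<^sup>2"
    using T by (simp add: r_def powr_power powr_numeral)
  have r2: "real T \<le> r\<^sup>2"
  proof -
    have "real T = real T powr 1" using T by simp
    also have "\<dots> \<le> real T powr (4/3)" using T by (intro powr_mono) auto
    also have "\<dots> = r\<^sup>2" using T by (simp add: r_def powr_power)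
    finally show ?thesis .
  qed
  have rl: "r \<le> r * l" "1 \<le> r * l" "r * l \<le> r * l\<^sup>2"
  proof -
    show "r \<le> r * l" using r1 l1 mult_left_mono[of 1 l r] by simp
    then show "1 \<le> r * l" using r1 by linarith
    then show "r * l \<le> r * l\<^sup>2" using l1 mult_left_mono[of 1 l "r * l"] by (simp add: power2_eq_square)
  qed
  have N: "800 * r * l \<le> real N" "real N \<le> 801 * r * l"
    using rl unfolding N_def by linarith+
  have N0: "N > 0" and rN: "r \<le> real N" using N rl by linarith+
  have K: "real K \<le> 30 * r" "K > 0" "4 + 2 * Mx \<le> K"
    using r1 unfolding K_def Mx_def by linarith+
  let ?L = "\<lambda>t v x. return_pmf (predict N t v x)"
  show "\<exists>L::learner. learner_measurable L \<and>
      (\<forall>(R::real measure) (A::real \<Rightarrow> adv) (D::pt measure) (w::pt) (b::real).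
         prob_space R \<longrightarrow> sets R = sets borel \<longrightarrow> adversary_measurable R A \<longrightarrow>
         prob_space D \<longrightarrow> sets D = sets borel \<longrightarrow>
         exp_err L A R D (halfspace w b) T \<le> ennreal (13000 * real T powr (2/3) * (1 + ln (real T)) ^ 2))"
  proof (intro exI[of _ ?L] conjI allI impI)
    show "learner_measurable ?L" by (intro learner_measurable_return measurable_predict)
  next
    fix R :: "real measure" and A :: "real \<Rightarrow> adv" and D :: "pt measure" and w b
    assume R: "prob_space R" and D: "prob_space D" "sets D = sets borel"
    interpret R: prob_space R by fact
    have Mx: "card {i. i < t \<and> mistake (v i)} \<le> Mx"
      if "labelled w b t v" "followed N t v" "t \<le> T" for t v
      using mistakes_le[OF that N0 rN r1 r3 r2] unfolding Mx_def by linarith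
    \<comment> \<open>The bound holds for every seed of the adversary, so averaging over
      \<open>R\<close> preserves it.\<close>
    have "V ?L (A \<rho>) D (halfspace w b) T 0 (\<lambda>_. default_ent) \<le> ennreal (13000 * r * l\<^sup>2)" for \<rho>
    proof -
      have "V ?L (A \<rho>) D (halfspace w b) T 0 (\<lambda>_. default_ent)
          \<le> of_nat Mx + (\<Sum>j\<in>{0..<T}. step_bound N j + ghost D K N j [])"
        using V_bound[where t = 0 and n = T and h = "\<lambda>_. default_ent" and A = "A \<rho>", OF D N0 K(3) Mx]
        by (simp add: labelled_def followed_def clean_def)
      also have "\<dots> = of_nat Mx + ((\<Sum>j\<in>{0..<T}. step_bound N j) + (\<Sum>j\<in>{0..<T}. ghost D K N j []))"
        by (simp add: sum.distrib)
      also have "\<dots> \<le> ennreal (13 * r) + (ennreal (1 + 16 * real N * l) + ennreal 1)"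
      proof (intro add_mono)
        show "of_nat Mx \<le> ennreal (13 * r)"
          using r1 unfolding Mx_def by (simp add: ennreal_of_nat_eq_real_of_nat ennreal_leI)
        show "(\<Sum>j\<in>{0..<T}. step_bound N j) \<le> ennreal (1 + 16 * real N * l)"
          unfolding l_def by (rule sum_step_bound[OF T])
        show "(\<Sum>j\<in>{0..<T}. ghost D K N j []) \<le> ennreal 1"
          using sum_ghost_Nil[OF D K(2) T deviation_bound_small[OF T l_def r1 K(1) N(1)]] by simp
      qed
      also have "\<dots> = ennreal (13 * r + (1 + 16 * real N * l + 1))"
      proof -
        have "0 \<le> 13 * r" "0 \<le> 1 + 16 * real N * l" "0 \<le> (1::real)" "0 \<le> 1 + 16 * real N * l + 1"
          using r1 l1 by auto
        then show ?thesis by (simp only: ennreal_plus)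
      qed
      also have "\<dots> \<le> ennreal (13000 * r * l\<^sup>2)"
      proof (rule ennreal_leI)
        have "real N * l \<le> 801 * r * l * l" using N(2) l1 by (intro mult_right_mono) auto
        then have "real N * l \<le> 801 * (r * l\<^sup>2)" by (simp add: power2_eq_square algebra_simps)
        then show "13 * r + (1 + 16 * real N * l + 1) \<le> 13000 * r * l\<^sup>2" using rl by (simp add: mult.assoc)
      qed
      finally show ?thesis .
    qed
    then have "exp_err ?L A R D (halfspace w b) T \<le> (\<integral>\<^sup>+ \<rho>. ennreal (13000 * r * l\<^sup>2) \<partial>R)"
      unfolding exp_err_def by (intro nn_integral_mono)
    also have "\<dots> = ennreal (13000 * r * l\<^sup>2)" by (simp add: R.emeasure_space_1)
    finally show "exp_err ?L A R D (halfspace w b) T \<le> ennreal (13000 * real T powr (2/3) * (1 + ln (real T)) ^ 2)"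
      by (simp add: r_def l_def)
  qed
qed

end
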